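(* Let $h\in X$, where $X$ is the $\mathrm{GL}_2(\mathbb{R})$-conjugacy class of the morphism $h_0:\mathbb{G}_{m,\mathbb{R}}^2\to \mathrm{GL}_{2,\mathbb{R}}$, $(x,y)\mapsto \mathrm{diag}(x,y)$. Then the Mumford-Tate group $\mathrm{MT}(h)\subset \mathrm{GL}_{2,\mathbb{Q}}$ of $h$ is of one of the following types: (1) $\mathrm{MT}(h)=\mathrm{GL}_{2,\mathbb{Q}}$ (the corresponding geodesic is then called MT-generic); (2) $\mathrm{MT}(h)\cong\mathrm{Res}_{E/\mathbb{Q}}\mathbb{G}_m$ with $E/\mathbb{Q}$ a real quadratic field (the corresponding geodesic is then called special, or is said to have real multiplication by $E$); (3) $\mathrm{MT}(h)\cong\mathbb{G}_{m,\mathbb{Q}}^2$ (the geodesic is then called rational).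
   Context: $\mathrm{GL}_2(\mathbb{R})$ acts by conjugation on the set $\mathrm{Hom}(\mathbb{G}_{m,\mathbb{R}}^2,\mathrm{GL}_{2,\mathbb{R}})$ of morphisms of real algebraic groups. $X:=\{g h_0 g^{-1} : g\in \mathrm{GL}_2(\mathbb{R})\}\cong \mathrm{GL}_2(\mathbb{R})/D(\mathbb{R})$, where $D(\mathbb{R})$ is the subgroup of diagonal matrices. The quotient $\mathrm{GL}_2(\mathbb{Z})\backslash X$ is the space of geodesics on the modular curve; the geodesic corresponding to $h\in X$ is its class in this quotient. For $h\in X$, the bad Mumford-Tate group $\mathrm{BMT}(h)$ is the smallest $\mathbb{Q}$-algebraic subgroup of $\mathrm{GL}_{2,\mathbb{Q}}$ such that $h((\mathbb{R}^* )^2)\subset \mathrm{BMT}(h)(\mathbb{R})$. A Mumford-Tate group for $h$ is a minimal reductive subgroup of $\mathrm{GL}_{2,\mathbb{Q}}$ containing $\mathrm{BMT}(h)$; there is a unique one for each $h$, denoted $\mathrm{MT}(h)$. $\mathrm{Res}_{E/\mathbb{Q}}\mathbb{G}_m$ denotes Weil restriction, i.e. $E^\times$ viewed as a $\mathbb{Q}$-algebraic group. *)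

theory Defs
  imports
    "HOL-Analysis.Analysis"
    "HOL-Algebra.Coset"
    "HOL-Algebra.Algebraic_Closure_Type"
begin

no_notation fps_nth (infixl "$" 75)

section \<open>Affine algebraic groups over subfields of the complex numbers\<close>

text \<open>
  Let \<open>k\<close> be a subfield of the complex numbers. An affine algebraic group over \<open>k\<close> is encoded by
  its group of complex points together with its \<open>k\<close>-algebra of regular functions, viewed as
  functions on the complex points. As the characteristic is zero, affine algebraic groups over
  \<open>k\<close> are reduced, so this data determines the group. Regular functions are total functions in
  HOL, but only their values on the carrier matter. An algebraic subgroup \<open>H\<close> of \<open>G\<close> is given by
  the set of its complex points; as an algebraic group in its own right it is
  \<open>G\<lparr>carrier := H\<rparr>\<close>, whose regular functions are the restrictions of those of \<open>G\<close>.
\<close>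

record 'a alg_group = "'a monoid" +
  regular :: "('a \<Rightarrow> complex) set"

text \<open>The \<open>k\<close>-algebra of functions generated by \<open>S\<close>.\<close>

inductive_set generated_algebra :: "complex set \<Rightarrow> ('a \<Rightarrow> complex) set \<Rightarrow> ('a \<Rightarrow> complex) set"
  for k S where
    const: "c \<in> k \<Longrightarrow> (\<lambda>_. c) \<in> generated_algebra k S"
  | gen: "f \<in> S \<Longrightarrow> f \<in> generated_algebra k S"
  | add: "f \<in> generated_algebra k S \<Longrightarrow> g \<in> generated_algebra k S
      \<Longrightarrow> (\<lambda>x. f x + g x) \<in> generated_algebra k S"
  | mult: "f \<in> generated_algebra k S \<Longrightarrow> g \<in> generated_algebra k S
      \<Longrightarrow> (\<lambda>x. f x * g x) \<in> generated_algebra k S"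

definition zariski_closed :: "'a alg_group \<Rightarrow> 'a set \<Rightarrow> bool" where
  "zariski_closed G S \<longleftrightarrow> (\<exists>F \<subseteq> regular G. S = {x \<in> carrier G. \<forall>f\<in>F. f x = 0})"

definition zariski_connected :: "'a alg_group \<Rightarrow> 'a set \<Rightarrow> bool" where
  "zariski_connected G S \<longleftrightarrow>
     \<not> (\<exists>A B. zariski_closed G A \<and> zariski_closed G B \<and> A \<noteq> {} \<and> B \<noteq> {} \<and> A \<inter> B = {} \<and> S = A \<union> B)"

definition alg_subgroup :: "'a set \<Rightarrow> 'a alg_group \<Rightarrow> bool" where
  "alg_subgroup H G \<longleftrightarrow> subgroup H G \<and> zariski_closed G H"

text \<open>For \<open>G\<close> over \<open>k \<subseteq> L\<close>, the \<open>L\<close>-points are the homomorphisms of \<open>k\<close>-algebras from the regular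
  functions to \<open>L\<close>, that is, the complex points at which all regular functions over \<open>k\<close> take
  values in \<open>L\<close>.\<close>

definition points :: "complex set \<Rightarrow> 'a alg_group \<Rightarrow> 'a set" where
  "points L G = {x \<in> carrier G. \<forall>f\<in>regular G. f x \<in> L}"

definition alg_hom :: "'a alg_group \<Rightarrow> 'b alg_group \<Rightarrow> ('a \<Rightarrow> 'b) set" where
  "alg_hom G H = {f \<in> hom G H.
     \<forall>\<phi>\<in>regular H. \<exists>\<psi>\<in>regular G. \<forall>x\<in>carrier G. \<phi> (f x) = \<psi> x}"

definition alg_isomorphic :: "'a alg_group \<Rightarrow> 'b alg_group \<Rightarrow> bool" where
  "alg_isomorphic G H \<longleftrightarrow> (\<exists>f\<in>alg_hom G H. \<exists>g\<in>alg_hom H G.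
     (\<forall>x\<in>carrier G. g (f x) = x) \<and> (\<forall>y\<in>carrier H. f (g y) = y))"

definition GL :: "complex set \<Rightarrow> (complex^'n^'n) alg_group" where
  "GL k = \<lparr>carrier = {A. invertible A}, monoid.mult = (**), one = mat 1,
     regular = generated_algebra k (insert (\<lambda>A. inverse (det A)) {\<lambda>A. A $ i $ j | i j. True})\<rparr>"

definition Gm2 :: "complex set \<Rightarrow> (complex \<times> complex) alg_group" where
  "Gm2 k = \<lparr>carrier = {(x, y). x \<noteq> 0 \<and> y \<noteq> 0},
     monoid.mult = (\<lambda>(x, y) (x', y'). (x * x', y * y')), one = (1, 1),
     regular = generated_algebra k
       {fst, snd, \<lambda>p. inverse (fst p), \<lambda>p. inverse (snd p)}\<rparr>"


section \<open>Weil restriction of the multiplicative group\<close>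

global_interpretation rat_real: vector_space "\<lambda>(q::rat) (x::real). of_rat q * x"
  by unfold_locales (simp_all add: algebra_simps of_rat_add of_rat_mult)

definition real_quadratic_field :: "real set \<Rightarrow> bool" where
  "real_quadratic_field E \<longleftrightarrow>
     subfield E (ring_of_type_algebra :: real ring) \<and> rat_real.dim E = 2"

definition rat_basis :: "real set \<Rightarrow> ('n::finite \<Rightarrow> real) \<Rightarrow> bool" where
  "rat_basis E b \<longleftrightarrow>
     inj b \<and> rat_real.independent (range b) \<and> rat_real.span (range b) = E"

text \<open>
  Let \<open>b\<close> be a basis over the rationals of a number field \<open>E\<close>. A vector \<open>v\<close> in
  \<open>complex^'n\<close> stands for the element \<open>\<Sum>i. b i \<otimes> v $ i\<close> of the tensor product of \<open>E\<close> with the complex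
  numbers over the rationals, and \<open>tensor_mult b\<close> and \<open>tensor_one b\<close> are the multiplication and unit of
  that algebra.
\<close>

definition tensor_mult :: "('n::finite \<Rightarrow> real) \<Rightarrow> complex^'n \<Rightarrow> complex^'n \<Rightarrow> complex^'n" where
  "tensor_mult b v w = (\<chi> l. \<Sum>i\<in>UNIV. \<Sum>j\<in>UNIV.
     of_rat (rat_real.representation (range b) (b i * b j) (b l)) * v $ i * w $ j)"

definition tensor_one :: "('n::finite \<Rightarrow> real) \<Rightarrow> complex^'n" where
  "tensor_one b = (\<chi> l. of_rat (rat_real.representation (range b) 1 (b l)))"

definition tensor_inverse :: "('n::finite \<Rightarrow> real) \<Rightarrow> complex^'n \<Rightarrow> complex^'n" where
  "tensor_inverse b v = (THE w. tensor_mult b v w = tensor_one b)"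

text \<open>
  The Weil restriction to the rationals of the multiplicative group of \<open>E\<close>, the latter written as
  the closed subscheme \<open>x y = 1\<close> of the plane: its complex points are the units of the tensor
  product, and its regular functions are generated over the rationals by the coordinates of \<open>x\<close>
  and of its inverse \<open>y\<close>. The isomorphism class does not depend on the basis.
\<close>

definition Res_Gm :: "('n::finite \<Rightarrow> real) \<Rightarrow> (complex^'n) alg_group" where
  "Res_Gm b = \<lparr>carrier = {v. \<exists>w. tensor_mult b v w = tensor_one b},
     monoid.mult = tensor_mult b, one = tensor_one b,
     regular = generated_algebra \<rat>
       ({\<lambda>v. v $ i | i. True} \<union> {\<lambda>v. tensor_inverse b v $ i | i. True})\<rparr>"


section \<open>Reductive groups\<close>

definition unipotent_matrix :: "complex^'n^'n \<Rightarrow> bool" where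
  "unipotent_matrix u \<longleftrightarrow> (\<exists>m. (((**) (u - mat 1)) ^^ m) (mat 1) = 0)"

text \<open>
  A linear algebraic group is reductive if its unipotent radical, i.e. the largest connected
  unipotent closed normal subgroup over the algebraically closed base field, is trivial.
  Connectedness of the group itself is not required.
\<close>

definition reductive :: "(complex^'n^'n) set \<Rightarrow> bool" where
  "reductive M \<longleftrightarrow>
     (\<forall>U. alg_subgroup U (GL UNIV) \<and> normal U ((GL UNIV)\<lparr>carrier := M\<rparr>) \<and>
          zariski_connected (GL UNIV) U \<and> (\<forall>u\<in>U. unipotent_matrix u)
        \<longrightarrow> U = {mat 1})"


section \<open>Mumford-Tate groups\<close>

text \<open>A morphism of real algebraic groups is represented by its effect on complex points.\<close>

definition h0 :: "complex \<times> complex \<Rightarrow> complex^2^2" where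
  "h0 = (\<lambda>(x, y). vector [vector [x, 0], vector [0, y]])"

definition conjugate_hom ::
  "complex^'n^'n \<Rightarrow> ('a \<Rightarrow> complex^'n^'n) \<Rightarrow> 'a \<Rightarrow> complex^'n^'n" where
  "conjugate_hom g h = (\<lambda>t. g ** h t ** matrix_inv g)"

definition X_h0 :: "(complex \<times> complex \<Rightarrow> complex^2^2) set" where
  "X_h0 = {conjugate_hom g h0 | g. g \<in> points \<real> (GL \<real>)}"

lemma group_GL: "group (GL k :: (complex^'n^'n) alg_group)"
proof (rule groupI)
  fix A :: "complex^'n^'n" assume "A \<in> carrier (GL k)"
  then show "\<exists>B\<in>carrier (GL k). B \<otimes>\<^bsub>GL k\<^esub> A = \<one>\<^bsub>GL k\<^esub>"
    by (auto simp: GL_def invertible_def)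
qed (auto simp: GL_def matrix_mul_assoc invertible_det_nz det_mul)

lemma image_points: "f ` points L G \<subseteq> points L H" if "f \<in> alg_hom G H"
proof (clarify)
  fix x assume x: "x \<in> points L G"
  then have "f x \<in> carrier H"
    using that by (auto simp: alg_hom_def hom_def points_def)
  moreover have "\<phi> (f x) \<in> L" if phi: "\<phi> \<in> regular H" for \<phi>
  proof -
    obtain \<psi> where "\<psi> \<in> regular G" "\<forall>x\<in>carrier G. \<phi> (f x) = \<psi> x"
      using \<open>f \<in> alg_hom G H\<close> phi unfolding alg_hom_def by blast
    then show ?thesis using x by (simp add: points_def)
  qed
  ultimately show "f x \<in> points L H" by (simp add: points_def)
qed

lemma generated_algebra_mono: "generated_algebra k S \<subseteq> generated_algebra k' S" if "k \<subseteq> k'"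
proof
  fix f assume "f \<in> generated_algebra k S"
  then show "f \<in> generated_algebra k' S"
    by induction (use that in \<open>auto intro: generated_algebra.intros\<close>)
qed

lemma points_GL_mono: "points L (GL k') \<subseteq> points L (GL k)" if "k \<subseteq> k'"
  using generated_algebra_mono[OF that] by (fastforce simp: points_def GL_def)

lemma generated_algebra_sum: "(\<lambda>x. \<Sum>i\<in>I. f i x) \<in> generated_algebra k S"
  if "0 \<in> k" "finite I" "\<And>i. i \<in> I \<Longrightarrow> f i \<in> generated_algebra k S"
  using that(2,3) by (induction I rule: finite_induct)
    (auto intro: generated_algebra.intros that(1))

lemma X_h0_subset_alg_hom: "X_h0 \<subseteq> alg_hom (Gm2 \<real>) (GL \<real>)"
proof
  fix h assume "h \<in> X_h0"
  then obtain g where h: "h = conjugate_hom g h0" and g: "g \<in> points \<real> (GL \<real>)"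
    by (auto simp: X_h0_def)
  have inv: "invertible g"
    using g by (simp add: points_def GL_def)
  then have ginv: "g ** matrix_inv g = mat 1" "matrix_inv g ** g = mat 1"
    unfolding invertible_def matrix_inv_def by (rule someI2_ex; simp)+
  have entry: "g $ i $ j \<in> \<real>" for i j
  proof -
    have "(\<lambda>A. A $ i $ j) \<in> regular (GL \<real>)"
      by (auto simp: GL_def intro!: generated_algebra.gen)
    then show ?thesis
      using g by (auto simp: points_def dest: bspec[where x = "\<lambda>A. A $ i $ j"])
  qed
  have det_real: "det g \<in> \<real>"
    by (simp add: det_2 entry)
  have h0_mult: "h0 p ** h0 q = h0 (fst p * fst q, snd p * snd q)" for p q
    by (auto simp: h0_def vec_eq_iff forall_2 matrix_matrix_mult_def sum_2 split: prod.splits)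
  have det_h0: "det (h0 p) = fst p * snd p" for p
    by (auto simp: h0_def det_2 split: prod.splits)
  have det_h: "det (h p) = fst p * snd p" for p
  proof -
    have "det (h p) = det (h0 p) * (det g * det (matrix_inv g))"
      by (simp add: h conjugate_hom_def det_mul mult_ac)
    also have "det g * det (matrix_inv g) = 1"
      by (metis det_I det_mul ginv(1))
    finally show ?thesis by (simp add: det_h0)
  qed
  have inv_entry: "matrix_inv g $ i $ j \<in> \<real>" for i j
  proof -
    define D where "D = det g"
    define K :: "complex^2^2" where
      "K = vector [vector [g$2$2 / D, - g$1$2 / D], vector [- g$2$1 / D, g$1$1 / D]]"
    have D: "D \<noteq> 0" "g$1$1 * g$2$2 - g$1$2 * g$2$1 = D"
      using inv by (simp_all add: D_def invertible_det_nz det_2)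
    have "K ** g = mat 1"
      using D by (simp add: K_def vec_eq_iff forall_2 matrix_matrix_mult_def sum_2 mat_def
          flip: diff_divide_distrib add_divide_distrib) (simp add: mult.commute)
    then have "matrix_inv g = K"
      by (metis ginv(1) matrix_mul_assoc matrix_mul_lid matrix_mul_rid)
    then show ?thesis
      using exhaust_2[of i] exhaust_2[of j]
      by (auto simp: K_def D_def intro!: Reals_divide entry det_real)
  qed
  have h_entry: "h p $ i $ j = g $ i $ 1 * matrix_inv g $ 1 $ j * fst p
      + g $ i $ 2 * matrix_inv g $ 2 $ j * snd p" for p i j
    by (simp add: h conjugate_hom_def h0_def matrix_matrix_mult_def sum_2 case_prod_unfold)
       
  have hom: "h \<in> hom (Gm2 \<real>) (GL \<real>)"
  proof (rule homI)
    fix p assume "p \<in> carrier (Gm2 \<real>)"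
    then show "h p \<in> carrier (GL \<real>)"
      by (auto simp: Gm2_def GL_def invertible_det_nz det_h)
  next
    fix p q
    have "h p ** h q = g ** h0 p ** (matrix_inv g ** g) ** h0 q ** matrix_inv g"
      by (simp add: h conjugate_hom_def matrix_mul_assoc)
    also have "\<dots> = g ** (h0 p ** h0 q) ** matrix_inv g"
      by (simp add: ginv matrix_mul_assoc)
    finally show "h (p \<otimes>\<^bsub>Gm2 \<real>\<^esub> q) = h p \<otimes>\<^bsub>GL \<real>\<^esub> h q"
      by (auto simp: Gm2_def GL_def h conjugate_hom_def h0_mult split: prod.splits)
  qed
  have "\<exists>\<psi>\<in>regular (Gm2 \<real>). \<forall>x\<in>carrier (Gm2 \<real>). \<phi> (h x) = \<psi> x" if "\<phi> \<in> regular (GL \<real>)" for \<phi>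
  proof -
    have "\<phi> \<in> generated_algebra \<real>
        (insert (\<lambda>A. inverse (det A)) {\<lambda>A :: complex^2^2. A $ i $ j | i j. True})"
      using that by (simp add: GL_def)
    then have "(\<lambda>x. \<phi> (h x)) \<in> regular (Gm2 \<real>)"
    proof induction
      case (gen f)
      then consider "f = (\<lambda>A. inverse (det A))" | i j where "f = (\<lambda>A. A $ i $ j)"
        by blast
      then show ?case
      proof cases
        case 1
        then show ?thesis
          unfolding 1 det_h inverse_mult_distrib Gm2_def alg_group.simps
          by - (rule generated_algebra.mult; rule generated_algebra.gen; simp)
      next
        case 2
        then show ?thesis
          unfolding 2 h_entry Gm2_def alg_group.simps
          by - (rule generated_algebra.add; rule generated_algebra.mult;
              (rule generated_algebra.const, intro Reals_mult entry inv_entry)?;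
              (rule generated_algebra.gen, simp)?)
      qed
    next
      case (const c)
      then show ?case
        unfolding Gm2_def alg_group.simps by (rule generated_algebra.const)
    next
      case (add f f')
      from add.IH show ?case
        unfolding Gm2_def alg_group.simps by (rule generated_algebra.add)
    next
      case (mult f f')
      from mult.IH show ?case
        unfolding Gm2_def alg_group.simps by (rule generated_algebra.mult)
    qed
    then show ?thesis by (rule bexI[rotated]) simp
  qed
  with hom show "h \<in> alg_hom (Gm2 \<real>) (GL \<real>)"
    unfolding alg_hom_def by (intro CollectI conjI ballI)
qed

definition BMT :: "(complex \<times> complex \<Rightarrow> complex^2^2) \<Rightarrow> (complex^2^2) set" where
  "BMT h = (LEAST G. alg_subgroup G (GL \<rat>) \<and>
     h ` points \<real> (Gm2 \<real>) \<subseteq> points \<real> ((GL \<rat>)\<lparr>carrier := G\<rparr>))"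

lemma BMT_smallest:
  defines "P \<equiv> \<lambda>h G. alg_subgroup G (GL \<rat>) \<and>
     h ` points \<real> (Gm2 \<real>) \<subseteq> points \<real> ((GL \<rat>)\<lparr>carrier := G\<rparr>)"
  assumes "h \<in> X_h0"
  shows "P h (BMT h)" and "P h G \<Longrightarrow> BMT h \<subseteq> G"
proof -
  let ?B = "\<Inter>{G. P h G}"
  have full: "P h (carrier (GL \<rat>))"
  proof -
    have "zariski_closed (GL \<rat> :: (complex^2^2) alg_group) (carrier (GL \<rat>))"
      unfolding zariski_closed_def by (rule exI[of _ "{}"]) simp
    then have sub: "alg_subgroup (carrier (GL \<rat>)) (GL \<rat> :: (complex^2^2) alg_group)"
      by (simp add: alg_subgroup_def group.subgroup_self[OF group_GL])
    have "h ` points \<real> (Gm2 \<real>) \<subseteq> points \<real> (GL \<real>)"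
      using image_points[OF subsetD[OF X_h0_subset_alg_hom assms(2)]] .
    also have "\<dots> \<subseteq> points \<real> (GL \<rat>)"
      by (rule points_GL_mono) (metis Rats_cases' Reals_divide Reals_of_int subsetI)
    finally show ?thesis
      using sub by (simp add: P_def)
  qed
  have sub: "subgroup ?B (GL \<rat>)"
  proof (rule group.subgroups_Inter[OF group_GL])
    show "{G. P h G} \<noteq> {}"
      using full by blast
  qed (simp add: P_def alg_subgroup_def)
  define F where "F G = {f \<in> regular (GL \<rat>). \<forall>x\<in>G. f x = 0}" for G :: "(complex^2^2) set"
  have F: "F G \<subseteq> regular (GL \<rat>) \<and> G = {x \<in> carrier (GL \<rat>). \<forall>f\<in>F G. f x = 0}"
    if "P h G" for G
  proof -
    obtain S where "S \<subseteq> regular (GL \<rat>)" "G = {x \<in> carrier (GL \<rat>). \<forall>f\<in>S. f x = 0}"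
      using \<open>P h G\<close> unfolding P_def alg_subgroup_def zariski_closed_def by auto
    then show ?thesis unfolding F_def by blast
  qed
  have closed: "zariski_closed (GL \<rat>) ?B"
    unfolding zariski_closed_def
  proof (intro exI conjI)
    show "(\<Union>G\<in>{G. P h G}. F G) \<subseteq> regular (GL \<rat>)"
      using F by blast
    show "?B = {x \<in> carrier (GL \<rat>). \<forall>f\<in>(\<Union>G\<in>{G. P h G}. F G). f x = 0}"
      (is "_ = ?Z")
    proof (intro equalityI subsetI)
      fix x assume x: "x \<in> ?B"
      then have "x \<in> carrier (GL \<rat>)" using full by blast
      moreover have "f x = 0" if "P h G" "f \<in> F G" for G f
      proof -
        have "x \<in> G" using x that(1) by blast
        then show ?thesis using F[OF that(1)] that(2) by blast
      qed
      ultimately show "x \<in> ?Z" by blast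
    next
      fix x assume x: "x \<in> ?Z"
      have "x \<in> G" if "P h G" for G
      proof -
        have "x \<in> {x \<in> carrier (GL \<rat>). \<forall>f\<in>F G. f x = 0}" using x that by blast
        then show ?thesis using F[OF that] by blast
      qed
      then show "x \<in> ?B" by blast
    qed
  qed
  have P_I: "P h G" if "alg_subgroup G (GL \<rat>)"
    "h ` points \<real> (Gm2 \<real>) \<subseteq> points \<real> ((GL \<rat>)\<lparr>carrier := G\<rparr>)" for G
    using that by (simp add: P_def)
  have "P h ?B"
  proof (rule P_I)
    show "alg_subgroup ?B (GL \<rat>)"
      unfolding alg_subgroup_def using sub closed by (rule conjI)
    show "h ` points \<real> (Gm2 \<real>) \<subseteq> points \<real> ((GL \<rat>)\<lparr>carrier := ?B\<rparr>)"
    proof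
      fix y assume y: "y \<in> h ` points \<real> (Gm2 \<real>)"
      have *: "y \<in> points \<real> ((GL \<rat>)\<lparr>carrier := G\<rparr>)" if "P h G" for G
        using y that unfolding P_def by blast
      then have "y \<in> points \<real> ((GL \<rat>)\<lparr>carrier := carrier (GL \<rat>)\<rparr>)"
        using full by blast
      then have "f y \<in> \<real>" if "f \<in> regular (GL \<rat>)" for f
        using that by (simp add: points_def)
      moreover have "y \<in> ?B"
        using * by (simp add: points_def)
      ultimately show "y \<in> points \<real> ((GL \<rat>)\<lparr>carrier := ?B\<rparr>)"
        by (simp add: points_def)
    qed
  qed
  have "BMT h = (LEAST G. P h G)"
    by (simp add: BMT_def P_def)
  also have "\<dots> = ?B"
    using \<open>P h ?B\<close> by (rule Least_equality) blast
  finally have "BMT h = ?B" .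
  with \<open>P h ?B\<close> show "P h (BMT h)"
    by simp
  show "BMT h \<subseteq> G" if "P h G"
    using that \<open>BMT h = ?B\<close> by blast
qed

definition reductive_containing_BMT ::
  "(complex \<times> complex \<Rightarrow> complex^2^2) \<Rightarrow> (complex^2^2) set \<Rightarrow> bool" where
  "reductive_containing_BMT h M \<longleftrightarrow> alg_subgroup M (GL \<rat>) \<and> reductive M \<and> BMT h \<subseteq> M"

definition is_Mumford_Tate_group ::
  "(complex \<times> complex \<Rightarrow> complex^2^2) \<Rightarrow> (complex^2^2) set \<Rightarrow> bool" where
  "is_Mumford_Tate_group h M \<longleftrightarrow> reductive_containing_BMT h M \<and>
     (\<forall>N. reductive_containing_BMT h N \<and> N \<subseteq> M \<longrightarrow> N = M)"

definition MT :: "(complex \<times> complex \<Rightarrow> complex^2^2) \<Rightarrow> (complex^2^2) set" where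
  "MT h = (THE M. is_Mumford_Tate_group h M)"

end

theory Submission
  imports Defs
begin

text \<open>
  Write \<open>h(x, y) = x e + y (1 - e)\<close> with a real idempotent \<open>e\<close> of rank one, and \<open>N = 2 e - 1\<close>, so that \<open>N\<^sup>2 = 1\<close>.
  By Zariski density every algebraic subgroup over the rationals containing \<open>BMT h\<close> contains the
  complex torus \<open>{x e + y (1 - e)}\<close>.

  If all products of two entries of \<open>N\<close> are rational, some multiple \<open>l N\<close> by a nonzero entry \<open>l\<close> is a
  rational matrix with square \<open>l\<^sup>2\<close>, and the torus is its centralizer, hence defined over the rationals and
  equal to \<open>MT h\<close>. It is split if \<open>l\<close> is rational, and otherwise the Weil restriction from the field generated
  by \<open>l\<close>.

  If some product \<open>z\<close> is irrational, a field embedding \<open>\<sigma>\<close> of the countable field generated by the entries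
  moves \<open>z\<close>, so \<open>\<sigma> N \<noteq> \<plusminus>N\<close>. A subgroup defined over the rationals that contains the torus also contains
  elements of the torus attached to \<open>\<sigma> N\<close>; it is then a Borel subgroup, which is not reductive, or the full
  group.
\<close>


section \<open>Field embeddings\<close>

hide_const (open) up_ring.coeff up_ring.monom Polynomials.degree Polynomials.lead_coeff

text \<open>Products of two entries are the right test because \<open>N\<close> and
  \<open>-N\<close> have the same torus, with its two eigenlines interchanged, and these products
  determine \<open>N\<close> exactly up to sign. The entries of \<open>N\<close> may be
  transcendental, so Galois theory of number fields does not apply, and an automorphism of all
  complex numbers would require a transcendence basis. As only finitely many entries matter, an
  embedding of a countable subfield suffices: countability leaves images free for transcendental
  elements, and separability gives algebraic ones a second conjugate. The embedding is applied only
  to torus elements with eigenvalues \<open>s\<close> and 1 for rational \<open>s\<close>, because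
  it fixes such scalars and moves nothing but \<open>N\<close>. The values 2, 3, 4 of
  \<open>s\<close> are enough: unless the moved elements are triangular, at most one value produces
  a vanishing diagonal entry, and the other two have different cross ratios. The real entries of
  \<open>g\<close> make \<open>l\<close> real, hence the quadratic field real. In both cases the
  candidate is contained in every competitor, so it is the only minimal group.\<close>

locale field_embedding =
  fixes K :: "complex set" and \<sigma> :: "complex \<Rightarrow> complex"
  assumes one_in: "1 \<in> K"
    and diff_in: "x \<in> K \<Longrightarrow> y \<in> K \<Longrightarrow> x - y \<in> K"
    and mult_in: "x \<in> K \<Longrightarrow> y \<in> K \<Longrightarrow> x * y \<in> K"
    and inverse_in: "x \<in> K \<Longrightarrow> inverse x \<in> K"
    and hom_diff: "x \<in> K \<Longrightarrow> y \<in> K \<Longrightarrow> \<sigma> (x - y) = \<sigma> x - \<sigma> y"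
    and hom_mult: "x \<in> K \<Longrightarrow> y \<in> K \<Longrightarrow> \<sigma> (x * y) = \<sigma> x * \<sigma> y"
    and hom_one: "\<sigma> 1 = 1"
begin

lemma zero_in: "0 \<in> K"
  using diff_in[OF one_in one_in] by simp

lemma uminus_in: "x \<in> K \<Longrightarrow> - x \<in> K"
  using diff_in[OF zero_in] by force

lemma add_in: "x \<in> K \<Longrightarrow> y \<in> K \<Longrightarrow> x + y \<in> K"
  using diff_in[OF _ uminus_in] by force

lemma divide_in: "x \<in> K \<Longrightarrow> y \<in> K \<Longrightarrow> x / y \<in> K"
  by (simp add: divide_inverse mult_in inverse_in)

lemma hom_zero: "\<sigma> 0 = 0"
  using hom_diff[OF one_in one_in] by simp

lemma hom_uminus: "x \<in> K \<Longrightarrow> \<sigma> (- x) = - \<sigma> x"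
  using hom_diff[OF zero_in] by (force simp: hom_zero)

lemma hom_add: "x \<in> K \<Longrightarrow> y \<in> K \<Longrightarrow> \<sigma> (x + y) = \<sigma> x + \<sigma> y"
  using hom_diff[OF _ uminus_in] by (force simp: hom_uminus)

lemma hom_eq_0: "x \<in> K \<Longrightarrow> \<sigma> x = 0 \<longleftrightarrow> x = 0"
  using hom_mult[of x "inverse x"] by (cases "x = 0") (auto simp: inverse_in hom_zero hom_one)

lemma hom_inverse: "x \<in> K \<Longrightarrow> \<sigma> (inverse x) = inverse (\<sigma> x)"
  using hom_mult[of x "inverse x"]
  by (cases "x = 0") (auto simp: inverse_in hom_zero hom_one inverse_unique)

lemma hom_divide: "x \<in> K \<Longrightarrow> y \<in> K \<Longrightarrow> \<sigma> (x / y) = \<sigma> x / \<sigma> y"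
  by (simp add: divide_inverse hom_mult hom_inverse inverse_in)

lemma of_nat_in: "of_nat n \<in> K"
  by (induction n) (auto intro: zero_in one_in add_in)

lemma hom_of_nat: "\<sigma> (of_nat n) = of_nat n"
  by (induction n) (auto simp: hom_zero hom_one hom_add one_in of_nat_in)

lemma of_int_in: "of_int n \<in> K"
  by (cases n) (auto intro: of_nat_in uminus_in simp del: of_nat_Suc)

lemma hom_of_int: "\<sigma> (of_int n) = of_int n"
  by (cases n) (auto simp: hom_of_nat hom_uminus of_nat_in simp del: of_nat_Suc)

lemma Rats_in: "q \<in> \<rat> \<Longrightarrow> q \<in> K"
  by (metis Rats_cases' divide_in of_int_in)

lemma hom_Rats: "q \<in> \<rat> \<Longrightarrow> \<sigma> q = q"
  by (metis Rats_cases' hom_divide hom_of_int of_int_in)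

lemma sum_in: "(\<And>i. i \<in> I \<Longrightarrow> f i \<in> K) \<Longrightarrow> sum f I \<in> K"
  by (induction I rule: infinite_finite_induct) (auto intro: zero_in add_in)

lemma hom_sum: "(\<And>i. i \<in> I \<Longrightarrow> f i \<in> K) \<Longrightarrow> \<sigma> (sum f I) = (\<Sum>i\<in>I. \<sigma> (f i))"
  by (induction I rule: infinite_finite_induct) (auto simp: hom_zero hom_add sum_in)

section \<open>Polynomials with coefficients in the subfield\<close>

definition polys :: "complex poly set" where
  "polys = {p. \<forall>i. coeff p i \<in> K}"

lemma coeff_in: "p \<in> polys \<Longrightarrow> coeff p i \<in> K"
  by (simp add: polys_def)

lemma zero_polys: "0 \<in> polys"
  by (simp add: polys_def zero_in)

lemma diff_polys: "p \<in> polys \<Longrightarrow> q \<in> polys \<Longrightarrow> p - q \<in> polys"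
  by (simp add: polys_def diff_in)

lemma add_polys: "p \<in> polys \<Longrightarrow> q \<in> polys \<Longrightarrow> p + q \<in> polys"
  by (simp add: polys_def add_in)

lemma mult_polys: "p \<in> polys \<Longrightarrow> q \<in> polys \<Longrightarrow> p * q \<in> polys"
  by (auto simp: polys_def coeff_mult intro!: sum_in mult_in)

lemma monom_polys: "c \<in> K \<Longrightarrow> monom c n \<in> polys"
  by (simp add: polys_def zero_in)

lemma pCons_polys: "c \<in> K \<Longrightarrow> p \<in> polys \<Longrightarrow> pCons c p \<in> polys"
  by (simp add: polys_def coeff_pCons split: nat.splits)

lemma pderiv_polys: "p \<in> polys \<Longrightarrow> pderiv p \<in> polys"
  by (auto simp: polys_def coeff_pderiv intro: mult_in of_nat_in simp del: of_nat_Suc)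

abbreviation hom_poly :: "complex poly \<Rightarrow> complex poly" where
  "hom_poly \<equiv> map_poly \<sigma>"

lemma coeff_hom_poly: "coeff (hom_poly p) i = \<sigma> (coeff p i)"
  by (simp add: coeff_map_poly hom_zero)

lemma hom_poly_diff: "p \<in> polys \<Longrightarrow> q \<in> polys \<Longrightarrow> hom_poly (p - q) = hom_poly p - hom_poly q"
  by (simp add: poly_eq_iff coeff_hom_poly polys_def hom_diff)

lemma hom_poly_add: "p \<in> polys \<Longrightarrow> q \<in> polys \<Longrightarrow> hom_poly (p + q) = hom_poly p + hom_poly q"
  by (simp add: poly_eq_iff coeff_hom_poly polys_def hom_add)

lemma hom_poly_mult: "p \<in> polys \<Longrightarrow> q \<in> polys \<Longrightarrow> hom_poly (p * q) = hom_poly p * hom_poly q"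
  by (simp add: poly_eq_iff coeff_hom_poly coeff_mult polys_def hom_sum hom_mult mult_in)

lemma hom_poly_pderiv: "p \<in> polys \<Longrightarrow> hom_poly (pderiv p) = pderiv (hom_poly p)"
  by (simp add: poly_eq_iff coeff_hom_poly coeff_pderiv polys_def hom_mult of_nat_in hom_of_nat
      del: of_nat_Suc)

lemma degree_hom_poly: "p \<in> polys \<Longrightarrow> degree (hom_poly p) = degree p"
proof (cases "p = 0")
  case False
  then show "p \<in> polys \<Longrightarrow> degree (hom_poly p) = degree p"
    by (intro map_poly_degree_eq) (simp add: hom_eq_0 polys_def)
qed simp

lemma hom_poly_eq_0: "p \<in> polys \<Longrightarrow> hom_poly p = 0 \<longleftrightarrow> p = 0"
  by (auto simp: poly_eq_iff coeff_hom_poly polys_def hom_eq_0)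

text \<open>Euclidean division only forms sums, products and quotients of coefficients, so carried
  out among complex polynomials it never leaves \<open>K\<close>.\<close>

lemma poly_division:
  assumes "m \<in> polys" "m \<noteq> 0" "p \<in> polys"
  shows "\<exists>q\<in>polys. \<exists>r\<in>polys. p = q * m + r \<and> (r = 0 \<or> degree r < degree m)"
  using assms(3)
proof (induction "degree p" arbitrary: p rule: less_induct)
  case less
  show ?case
  proof (cases "p = 0 \<or> degree p < degree m")
    case True
    with less.prems show ?thesis
      by (intro bexI[of _ 0] bexI[of _ p]) (auto simp: zero_polys)
  next
    case False
    \<comment> \<open>\<open>c * m\<close> has the degree and the leading coefficient of
      \<open>p\<close>, so subtracting it lowers the degree or leaves zero.\<close>
    define c where "c = monom (lead_coeff p / lead_coeff m) (degree p - degree m)"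
    have c: "c \<in> polys"
      using assms less.prems unfolding c_def by (intro monom_polys divide_in coeff_in)
    then have p': "p - c * m \<in> polys"
      using assms less.prems by (intro diff_polys mult_polys)
    have deg: "degree (c * m) = degree p"
      using False assms by (auto simp: c_def degree_mult_eq degree_monom_eq monom_eq_0_iff)
    have lc: "lead_coeff (c * m) = lead_coeff p"
      unfolding lead_coeff_mult using False assms by (simp add: c_def degree_monom_eq)
    show ?thesis
    proof (cases "p - c * m = 0")
      case True
      with c show ?thesis
        by (intro bexI[of _ c] bexI[of _ 0]) (auto simp: zero_polys)
    next
      case p0: False
      have "degree p > 0"
      proof (rule ccontr)
        assume "\<not> degree p > 0"
        then have "p - c * m = [:lead_coeff p - lead_coeff (c * m):]"
          using deg by (metis degree_eq_zeroE diff_pCons diff_zero lead_coeff_pCons(2)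
              bot_nat_0.not_eq_extremum)
        with lc p0 show False by simp
      qed
      then have "degree (p - c * m) < degree p"
        using deg lc by (metis coeff_diff degree_diff_le diff_self leading_coeff_0_iff
            le_neq_implies_less order_refl p0)
      with less.hyps[OF this p'] obtain q r where
        qr: "q \<in> polys" "r \<in> polys" "p - c * m = q * m + r" "r = 0 \<or> degree r < degree m"
        by blast
      then have "p = (q + c) * m + r"
        by (simp add: algebra_simps)
      with qr c show ?thesis
        by (intro bexI[of _ "q + c"] bexI[of _ r]) (auto intro: add_polys)
    qed
  qed
qed

lemma countable_polys:
  assumes "countable K"
  shows "countable polys"
proof -
  have "p \<in> Poly ` lists K" if p: "p \<in> polys" for p
  proof
    show "p = Poly (coeffs p)" by simp
    show "coeffs p \<in> lists K"
    proof (rule in_listsI, rule ballI)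
      fix c assume "c \<in> set (coeffs p)"
      then obtain i where "c = coeff p i"
        by (metis insertI2 rangeE range_coeff)
      then show "c \<in> K"
        using coeff_in[OF p] by simp
    qed
  qed
  then have "polys \<subseteq> Poly ` lists K"
    by (rule subsetI)
  then show ?thesis
    by (rule countable_subset) (intro countable_image countable_lists assms)
qed

text \<open>The equivalence is exactly what an extension of \<open>\<sigma>\<close> sending
  \<open>x\<close> to \<open>y\<close> requires. A transcendental \<open>x\<close> may go to any
  number outside countably many roots. An algebraic \<open>x\<close> outside \<open>K\<close> has a
  minimal polynomial of degree at least two, whose image has a root other than
  \<open>w\<close>.\<close>

lemma conjugate_root:
  assumes "x \<notin> K" "countable K"
  obtains y where "y \<noteq> w" "\<And>p. p \<in> polys \<Longrightarrow> poly (hom_poly p) y = 0 \<longleftrightarrow> poly p x = 0"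
proof (cases "\<exists>p\<in>polys. p \<noteq> 0 \<and> poly p x = 0")
  case False
  have "countable (insert w (\<Union>p\<in>polys - {0}. {y. poly (hom_poly p) y = 0}))"
    using countable_polys[OF assms(2)]
    by (auto intro!: countable_UN countable_finite[OF poly_roots_finite] simp: hom_poly_eq_0)
  then obtain y where y: "y \<notin> insert w (\<Union>p\<in>polys - {0}. {y. poly (hom_poly p) y = 0})"
    using uncountable_UNIV_complex by (metis UNIV_eq_I)
  show ?thesis
  proof (rule that)
    show "y \<noteq> w" using y by blast
    show "poly (hom_poly p) y = 0 \<longleftrightarrow> poly p x = 0" if "p \<in> polys" for p
      using y that False by (cases "p = 0") auto
  qed
next
  case True
  then obtain m where m: "m \<in> polys" "m \<noteq> 0" "poly m x = 0"
    and "\<forall>p. p \<in> polys \<and> p \<noteq> 0 \<and> poly p x = 0 \<longrightarrow> degree m \<le> degree p"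
    using arg_min_nat_lemma[of "\<lambda>p. p \<in> polys \<and> p \<noteq> 0 \<and> poly p x = 0" _ degree]
    by blast
  then have min: "degree m \<le> degree p" if "p \<in> polys" "p \<noteq> 0" "poly p x = 0" for p
    using that by blast
  have root: "poly (hom_poly p) y = 0 \<longleftrightarrow> poly p x = 0"
    if y: "poly (hom_poly m) y = 0" and p: "p \<in> polys" for p y
  proof
    assume 0: "poly p x = 0"
    obtain q r where qr: "q \<in> polys" "r \<in> polys" "p = q * m + r" "r = 0 \<or> degree r < degree m"
      using poly_division[OF m(1,2) p] by blast
    with 0 m min have "r = 0"
      by force
    with qr m y show "poly (hom_poly p) y = 0"
      by (simp add: hom_poly_mult)
  next
    assume p0: "poly (hom_poly p) y = 0"
    \<comment> \<open>This is irreducibility of \<open>m\<close> in disguise: a polynomial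
      \<open>n\<close> of least degree whose image kills \<open>y\<close> divides \<open>m\<close>;
      the cofactor has smaller degree than \<open>m\<close>, so it cannot vanish at
      \<open>x\<close>, and therefore \<open>n\<close> does.\<close>
    obtain n where n: "n \<in> polys" "n \<noteq> 0" "poly (hom_poly n) y = 0"
      and n': "\<forall>p. p \<in> polys \<and> p \<noteq> 0 \<and> poly (hom_poly p) y = 0 \<longrightarrow> degree n \<le> degree p"
      using arg_min_nat_lemma[of "\<lambda>p. p \<in> polys \<and> p \<noteq> 0 \<and> poly (hom_poly p) y = 0" m degree]
        m y by blast
    have dvd: "\<exists>q\<in>polys. p = q * n" if p: "p \<in> polys" "poly (hom_poly p) y = 0" for p
    proof -
      obtain q r where qr: "q \<in> polys" "r \<in> polys" "p = q * n + r" "r = 0 \<or> degree r < degree n"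
        using poly_division[OF n(1,2) p(1)] by blast
      with p(2) n have "poly (hom_poly r) y = 0"
        by (simp add: hom_poly_add hom_poly_mult mult_polys)
      with qr n' have "r = 0"
        by force
      with qr show ?thesis by auto
    qed
    obtain q where q: "q \<in> polys" "m = q * n"
      using dvd[OF m(1) y] by blast
    have "degree n > 0"
    proof (rule ccontr)
      assume "\<not> degree n > 0"
      then obtain c where c: "n = [:c:]"
        by (meson degree_eq_zeroE gr0I)
      with n show False
        using coeff_in[OF n(1), of 0] by (simp add: map_poly_pCons hom_zero hom_eq_0)
    qed
    then have "degree q < degree m"
      using q m by (auto simp: degree_mult_eq)
    then have "poly q x \<noteq> 0"
      using min[of q] q m by auto
    then have "poly n x = 0"
      using m q by simp
    then show "poly p x = 0"
      using dvd[OF p p0] by auto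
  qed
  have deg_pos: "degree m > 0"
    using m by (metis degree_eq_zeroE gr0I pCons_0_0 poly_const_conv)
  have deg: "degree m \<noteq> 1"
  proof
    assume "degree m = 1"
    then obtain a b where ab: "m = [:a, b:]" "b \<noteq> 0"
      using degree1_coeffs by metis
    then have "x = - a / b"
      using m by (simp add: field_simps add_eq_0_iff)
    moreover have "a \<in> K" "b \<in> K"
      using coeff_in[OF m(1), of 0] coeff_in[OF m(1), of 1] ab by auto
    ultimately show False
      using assms(1) by (metis divide_in uminus_in)
  qed
  have "\<exists>y. y \<noteq> w \<and> poly (hom_poly m) y = 0"
  proof (cases "poly (hom_poly m) w = 0")
    case False
    have "\<not> constant (poly (hom_poly m))"
      using deg_pos m degree_hom_poly by (simp add: constant_degree)
    with False show ?thesis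
      using fundamental_theorem_of_algebra by metis
  next
    case True
    \<comment> \<open>\<open>m\<close> is separable: its derivative does not vanish at \<open>x\<close>, hence neither at a root of \<open>\<sigma> m\<close>.\<close>
    have "pderiv m \<noteq> 0" "degree (pderiv m) < degree m"
      using deg_pos by (auto simp: pderiv_eq_0_iff degree_pderiv)
    then have "poly (pderiv m) x \<noteq> 0"
      using min[of "pderiv m"] pderiv_polys[OF m(1)] by auto
    then have d: "poly (pderiv (hom_poly m)) w \<noteq> 0"
      using root[OF True pderiv_polys[OF m(1)]] by (simp add: hom_poly_pderiv m)
    \<comment> \<open>Splitting off the simple root \<open>w\<close> leaves a factor of positive
      degree, none of whose roots is \<open>w\<close>.\<close>
    obtain k where k: "hom_poly m = [:-w, 1:] * k"
      using True by (auto simp: poly_eq_0_iff_dvd dvd_def)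
    have "poly k w \<noteq> 0"
      using d unfolding k pderiv_mult by (simp add: pderiv_pCons)
    have "k \<noteq> 0"
      using k m hom_poly_eq_0 by force
    then have "degree (hom_poly m) = Suc (degree k)"
      unfolding k by (subst degree_mult_eq) auto
    then have "degree k \<noteq> 0"
      using deg deg_pos degree_hom_poly m by auto
    then obtain y where "poly k y = 0"
      using fundamental_theorem_of_algebra constant_degree by metis
    with \<open>poly k w \<noteq> 0\<close> k show ?thesis
      by (metis mult_zero_right poly_mult)
  qed
  with root show ?thesis
    using that by blast
qed

text \<open>The field \<open>K(x)\<close> consists of quotients of polynomial values at
  \<open>x\<close>; the embedding replaces \<open>x\<close> by \<open>y\<close> and coefficients by
  their images. The hypothesis on roots keeps denominators nonzero and makes the value independent
  of the quotient.\<close>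

lemma simple_extension:
  assumes "countable K"
    and y: "\<And>p. p \<in> polys \<Longrightarrow> poly (hom_poly p) y = 0 \<longleftrightarrow> poly p x = 0"
  obtains K' \<tau> where "field_embedding K' \<tau>" "countable K'" "K \<subseteq> K'" "x \<in> K'"
    "\<And>z. z \<in> K \<Longrightarrow> \<tau> z = \<sigma> z" "\<tau> x = y"
proof -
  define S where "S = polys \<times> {q \<in> polys. poly q x \<noteq> 0}"
  define ev where "ev = (\<lambda>(p, q). poly p x / poly q x)"
  define ev' where "ev' = (\<lambda>(p, q). poly (hom_poly p) y / poly (hom_poly q) y)"
  define K' where "K' = ev ` S"
  \<comment> \<open>\<open>inv_into\<close> picks an arbitrary fraction representing
    \<open>z\<close>; the next fact shows that the choice does not matter.\<close>
  define \<tau> where "\<tau> = (\<lambda>z. ev' (inv_into S ev z))"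
  have \<tau>: "\<tau> (poly p x / poly q x) = poly (hom_poly p) y / poly (hom_poly q) y"
    if pq: "p \<in> polys" "q \<in> polys" "poly q x \<noteq> 0" for p q
  proof -
    let ?z = "poly p x / poly q x"
    have "?z = ev (p, q)" "(p, q) \<in> S"
      using pq by (auto simp: ev_def S_def)
    then have z: "?z \<in> ev ` S"
      by (metis imageI)
    obtain r s where rs: "inv_into S ev ?z = (r, s)"
      by fastforce
    have "(r, s) \<in> S" "ev (r, s) = ?z"
      using inv_into_into[OF z] f_inv_into_f[OF z] by (auto simp: rs)
    then have rs': "r \<in> polys" "s \<in> polys" "poly s x \<noteq> 0"
      "poly r x / poly s x = poly p x / poly q x"
      by (auto simp: S_def ev_def)
    then have "poly (r * q - p * s) x = 0"
      using pq by (simp add: field_simps)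
    then have "poly (hom_poly (r * q - p * s)) y = 0"
      using y[of "r * q - p * s"] pq rs' by (simp add: diff_polys mult_polys)
    then have "poly (hom_poly r) y * poly (hom_poly q) y = poly (hom_poly p) y * poly (hom_poly s) y"
      using pq rs' by (simp add: hom_poly_diff hom_poly_mult mult_polys)
    moreover have "poly (hom_poly q) y \<noteq> 0" "poly (hom_poly s) y \<noteq> 0"
      using pq rs' y by auto
    ultimately show ?thesis
      by (simp add: \<tau>_def rs ev'_def field_simps)
  qed
  have K'I: "poly p x / poly q x \<in> K'" if "p \<in> polys" "q \<in> polys" "poly q x \<noteq> 0" for p q
    using that unfolding K'_def S_def ev_def by (intro image_eqI[of _ _ "(p, q)"]) auto
  have K'E: "\<exists>p q. p \<in> polys \<and> q \<in> polys \<and> poly q x \<noteq> 0 \<and> z = poly p x / poly q x" if "z \<in> K'" for z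
    using that by (auto simp: K'_def S_def ev_def)
  have one: "[:1:] \<in> polys"
    by (intro pCons_polys one_in zero_polys)
  have K'_poly: "poly p x \<in> K'" "\<tau> (poly p x) = poly (hom_poly p) y" if "p \<in> polys" for p
    using K'I[of p "[:1:]"] \<tau>[of p "[:1:]"] that one
    by (auto simp: hom_one map_poly_pCons hom_zero)
  have nz: "poly (hom_poly q) y \<noteq> 0" if "q \<in> polys" "poly q x \<noteq> 0" for q
    using that y by simp
  have "field_embedding K' \<tau>"
  proof
    show "1 \<in> K'" "\<tau> 1 = 1"
      using K'_poly[OF one] by (auto simp: map_poly_pCons hom_zero hom_one)
    fix z assume "z \<in> K'"
    then obtain p q where pq: "p \<in> polys" "q \<in> polys" "poly q x \<noteq> 0" "z = poly p x / poly q x"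
      using K'E by blast
    show "inverse z \<in> K'"
    proof (cases "poly p x = 0")
      case True
      then show ?thesis using \<open>z \<in> K'\<close> pq by simp
    next
      case False
      then show ?thesis using K'I[of q p] pq by simp
    qed
    fix z' assume "z' \<in> K'"
    then obtain r s where rs: "r \<in> polys" "s \<in> polys" "poly s x \<noteq> 0" "z' = poly r x / poly s x"
      using K'E by blast
    have "z - z' = poly (p * s - r * q) x / poly (q * s) x"
      using pq(3) rs(3) unfolding pq(4) rs(4) by (simp add: field_simps)
    moreover have mem: "p * s - r * q \<in> polys" "q * s \<in> polys" "poly (q * s) x \<noteq> 0"
      using pq rs by (simp_all add: diff_polys mult_polys)
    ultimately show "z - z' \<in> K'"
      using K'I by metis
    have "\<tau> (z - z') = poly (hom_poly (p * s - r * q)) y / poly (hom_poly (q * s)) y"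
      unfolding \<open>z - z' = _\<close> using mem by (rule \<tau>)
    also have "\<dots> = poly (hom_poly p) y / poly (hom_poly q) y - poly (hom_poly r) y / poly (hom_poly s) y"
      using nz[OF pq(2,3)] nz[OF rs(2,3)] pq rs
      by (simp add: hom_poly_diff hom_poly_mult mult_polys divide_simps)
    finally show "\<tau> (z - z') = \<tau> z - \<tau> z'"
      using \<tau> pq rs by simp
    have "z * z' = poly (p * r) x / poly (q * s) x"
      using pq(3) rs(3) unfolding pq(4) rs(4) by (simp add: field_simps)
    moreover have mem: "p * r \<in> polys" "q * s \<in> polys" "poly (q * s) x \<noteq> 0"
      using pq rs by (simp_all add: mult_polys)
    ultimately show "z * z' \<in> K'"
      using K'I by metis
    have "\<tau> (z * z') = poly (hom_poly (p * r)) y / poly (hom_poly (q * s)) y"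
      unfolding \<open>z * z' = _\<close> using mem by (rule \<tau>)
    then show "\<tau> (z * z') = \<tau> z * \<tau> z'"
      using \<tau> pq rs by (simp add: hom_poly_mult)
  qed
  moreover have "countable K'"
  proof -
    show ?thesis
      using countable_polys[OF assms(1)] unfolding K'_def S_def by (intro countable_image countable_SIGMA) (auto intro: countable_subset)
  qed
  moreover have "z \<in> K'" "\<tau> z = \<sigma> z" if "z \<in> K" for z
    using K'_poly[of "[:z:]"] that by (auto simp: pCons_polys zero_polys map_poly_pCons hom_zero)
  moreover have "x \<in> K'" "\<tau> x = y"
    using K'_poly[of "[:0, 1:]"]
    by (auto simp: pCons_polys zero_polys zero_in one_in map_poly_pCons hom_zero hom_one)
  ultimately show ?thesis
    using that by blast
qed

text \<open>The forbidden value \<open>w\<close> is there to be taken as \<open>x\<close> itself,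
  which forces a newly adjoined element to be moved.\<close>

lemma extension:
  assumes "countable K"
  obtains K' \<tau> where "field_embedding K' \<tau>" "countable K'" "K \<subseteq> K'" "x \<in> K'"
    "\<And>z. z \<in> K \<Longrightarrow> \<tau> z = \<sigma> z" "x \<notin> K \<Longrightarrow> \<tau> x \<noteq> w"
proof (cases "x \<in> K")
  case True
  show ?thesis
    by (rule that[of K \<sigma>]) (use True assms field_embedding_axioms in auto)
next
  case False
  obtain y where "y \<noteq> w" "\<And>p. p \<in> polys \<Longrightarrow> poly (hom_poly p) y = 0 \<longleftrightarrow> poly p x = 0"
    using conjugate_root[OF False assms] by blast
  then show ?thesis
    using simple_extension[OF assms, of y x] that by metis
qed

end

lemma embedding_moving_irrational:
  assumes "z \<notin> \<rat>" "finite S"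
  obtains K \<sigma> where "field_embedding K \<sigma>" "insert z S \<subseteq> K" "\<sigma> z \<noteq> z"
proof -
  have "\<exists>K \<sigma>. field_embedding K \<sigma> \<and> countable K \<and> insert z S \<subseteq> K \<and> \<sigma> z \<noteq> z"
    using assms(2)
  proof (induction S rule: finite_induct)
    case empty
    \<comment> \<open>\<open>z\<close> is adjoined to the rationals before everything else, while it
      is still free to move; the later extensions keep its image.\<close>
    have Q: "field_embedding \<rat> id"
      by unfold_locales auto
    show ?case
      using field_embedding.extension[OF Q countable_rat, of z z] assms(1)
      by (metis empty_subsetI insert_subset)
  next
    case (insert x S)
    then obtain K \<sigma> where *: "field_embedding K \<sigma>" "countable K" "insert z S \<subseteq> K" "\<sigma> z \<noteq> z"
      by blast
    obtain K' \<tau> where **: "field_embedding K' \<tau>" "countable K'" "K \<subseteq> K'" "x \<in> K'"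
      "\<And>z. z \<in> K \<Longrightarrow> \<tau> z = \<sigma> z"
      using field_embedding.extension[OF *(1,2), of x] by metis
    have "insert z (insert x S) \<subseteq> K'" "\<tau> z \<noteq> z"
      using * ** by auto
    with ** show ?case by blast
  qed
  then show ?thesis using that by blast
qed

section \<open>Two by two matrices by their entries\<close>

definition mat2 :: "'a::zero \<Rightarrow> 'a \<Rightarrow> 'a \<Rightarrow> 'a \<Rightarrow> 'a^2^2" where
  "mat2 a b c d = vector [vector [a, b], vector [c, d]]"

lemma mat2_nth [simp]:
  "mat2 a b c d $ 1 $ 1 = a" "mat2 a b c d $ 1 $ 2 = b"
  "mat2 a b c d $ 2 $ 1 = c" "mat2 a b c d $ 2 $ 2 = d"
  by (simp_all add: mat2_def)

lemma mat2_eq_iff: "A = B \<longleftrightarrow> A$1$1 = B$1$1 \<and> A$1$2 = B$1$2 \<and> A$2$1 = B$2$1 \<and> A$2$2 = B$2$2"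
  for A B :: "'a^2^2"
  by (auto simp: vec_eq_iff forall_2)

lemma mat2_cases: obtains a b c d where "A = mat2 a b c d"
  using that[of "A$1$1" "A$1$2" "A$2$1" "A$2$2"] by (simp add: mat2_eq_iff)

lemma mat2_mult:
  "mat2 a b c d ** mat2 a' b' c' d'
    = mat2 (a * a' + b * c') (a * b' + b * d') (c * a' + d * c') (c * b' + d * d' :: 'a::comm_semiring_1)"
  by (simp add: mat2_eq_iff matrix_matrix_mult_def sum_2)

lemma mat2_add: "mat2 a b c d + mat2 a' b' c' d' = mat2 (a + a') (b + b') (c + c') (d + d' :: 'a::ring_1)"
  by (simp add: mat2_eq_iff)

lemma mat_mat2: "mat x = mat2 x 0 0 (x :: 'a::zero)"
  by (simp add: mat2_eq_iff mat_def)

lemma zero_mat2: "0 = mat2 0 0 0 (0 :: 'a::zero)"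
  by (simp add: mat2_eq_iff)

lemma det_mat2: "det (mat2 a b c d) = a * d - b * (c :: 'a::comm_ring_1)"
  by (simp add: det_2)

lemma mat2_eq_mat2 [simp]: "mat2 a b c d = mat2 a' b' c' d' \<longleftrightarrow> a = a' \<and> b = b' \<and> c = c' \<and> d = d'"
  by (simp add: mat2_eq_iff)

lemma invertible_mat2: "invertible (mat2 a b c d) \<longleftrightarrow> a * d - b * c \<noteq> (0 :: 'a::field)"
  by (simp add: invertible_det_nz det_mat2)

lemma h0_mat2: "h0 (x, y) = mat2 x 0 0 y"
  by (simp add: h0_def mat2_def)

text \<open>Scalar multiples are written as products with \<open>mat c\<close>, so that conjugation,
  being multiplicative, handles them without separate rules.\<close>

lemma mat_mult_nth [simp]: "(mat c ** A) $ i $ j = c * A $ i $ (j :: 'n::finite)"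
  for c :: "'a::comm_semiring_1"
  by (simp add: matrix_matrix_mult_def mat_def if_distrib[of "\<lambda>x. x * _"] cong: if_cong)

lemma mult_mat_commute: "A ** mat c = mat c ** A" for c :: "'a::comm_semiring_1" and A :: "'a^'n^'n"
  by (simp add: vec_eq_iff) (simp add: matrix_matrix_mult_def mat_def if_distrib mult.commute cong: if_cong)


lemma matrix_add_rdistrib: "(A + B) ** C = A ** C + B ** C" for C :: "'a::semiring_1^'n^'m"
  by (simp add: vec_eq_iff matrix_matrix_mult_def distrib_right sum.distrib)


section \<open>Submonoids of the general linear group that contain the diagonal torus\<close>

locale torus_submonoid =
  fixes G :: "('a::field^2^2) set"
  assumes inv: "A \<in> G \<Longrightarrow> invertible A"
    and mult: "A \<in> G \<Longrightarrow> B \<in> G \<Longrightarrow> A ** B \<in> G"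
    and diag: "x \<noteq> 0 \<Longrightarrow> y \<noteq> 0 \<Longrightarrow> mat2 x 0 0 y \<in> G"
begin

text \<open>Transposition fixes diagonal matrices and exchanges the two triangular shapes, which
  transfers results from upper to lower triangular matrices.\<close>

lemma transposed: "torus_submonoid (transpose ` G)"
proof
  have *: "transpose (mat2 x 0 0 y) = mat2 x 0 0 y" for x y :: 'a
    by (simp add: mat2_eq_iff transpose_def)
  show "mat2 x 0 0 y \<in> transpose ` G" if "x \<noteq> 0" "y \<noteq> 0" for x y
    using diag[OF that] * by (metis imageI)
  show "invertible A" if "A \<in> transpose ` G" for A
    using that inv by (auto simp: invertible_det_nz)
qed (use mult in \<open>auto simp flip: matrix_transpose_mul\<close>)

text \<open>Diagonal factors on both sides rescale the three entries independently of each
  other.\<close>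

lemma upper_triangular:
  assumes "mat2 a b 0 d \<in> G" "b \<noteq> 0" "p \<noteq> 0" "r \<noteq> 0"
  shows "mat2 p q 0 r \<in> G"
proof (cases "q = 0")
  case True
  then show ?thesis using assms diag by simp
next
  case False
  have ad: "a \<noteq> 0" "d \<noteq> 0"
    using inv[OF assms(1)] by (auto simp: invertible_mat2)
  have "mat2 (q / b) 0 0 (r / d) ** mat2 a b 0 d ** mat2 (p * b / (q * a)) 0 0 1 \<in> G"
    using False ad assms by (intro mult diag) auto
  then show ?thesis
    using False ad assms by (simp add: mat2_mult)
qed

text \<open>This is the big Bruhat cell: every invertible matrix with nonzero lower left entry lies
  in the double coset of \<open>B\<close> under the upper triangular group.\<close>

lemma full_if_upper:
  assumes "\<And>p q r. p \<noteq> 0 \<Longrightarrow> r \<noteq> 0 \<Longrightarrow> mat2 p q 0 r \<in> G"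
    and "B \<in> G" "B $ 2 $ 1 \<noteq> 0"
  shows "G = {A. invertible A}"
proof (intro equalityI subsetI CollectI)
  fix A assume "A \<in> {A :: 'a^2^2. invertible A}"
  obtain p q r s where A: "A = mat2 p q r s" by (rule mat2_cases)
  obtain a b c d where B: "B = mat2 a b c d" by (rule mat2_cases)
  have c: "c \<noteq> 0" and detB: "a * d - b * c \<noteq> 0" and detA: "p * s - q * r \<noteq> 0"
    using assms inv[OF assms(2)] \<open>A \<in> _\<close> A by (simp_all add: B invertible_mat2)
  show "A \<in> G"
  proof (cases "r = 0")
    case True
    then show ?thesis using assms(1) A detA by simp
  next
    case False
    \<comment> \<open>The product below has first column \<open>(p, r)\<close> and lower right entry
      \<open>s\<close> whatever \<open>w\<close> is. This \<open>w\<close> also gives it the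
      determinant of \<open>A\<close>, which fixes the upper right entry because \<open>r\<close> is
      nonzero.\<close>
    define w where "w = (p * s - q * r) * c / (r * (a * d - b * c))"
    have "mat2 1 ((p * c / r - a) / c) 0 1 ** B ** mat2 (r / c) ((s - d * w) / c) 0 w \<in> G"
      using False c detB detA assms by (intro mult) (auto simp: w_def)
    also have "mat2 1 ((p * c / r - a) / c) 0 1 ** B ** mat2 (r / c) ((s - d * w) / c) 0 w = A"
    proof -
      have w: "w * (r * (a * d - b * c)) = (p * s - q * r) * c"
        using False detB by (simp add: w_def)
      have "(b + (p * c / r - a) / c * d) * w = q - (p * c / r) * ((s - d * w) / c)"
        using False c w by (simp add: field_simps) algebra
      then show ?thesis
        using False c by (simp add: A B mat2_mult)
    qed
    finally show ?thesis .
  qed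
qed (use inv in simp)

lemma full_or_upper:
  assumes "mat2 a b 0 d \<in> G" "b \<noteq> 0"
  shows "G = {A. invertible A} \<or> G = {A. invertible A \<and> A $ 2 $ 1 = 0}"
proof (cases "\<exists>B\<in>G. B $ 2 $ 1 \<noteq> 0")
  case True
  then show ?thesis
    using full_if_upper upper_triangular[OF assms] by blast
next
  case False
  have "A \<in> G" if "invertible A" "A $ 2 $ 1 = 0" for A
    using that upper_triangular[OF assms] by (cases A rule: mat2_cases) (auto simp: invertible_mat2)
  with False inv show ?thesis
    by blast
qed

lemma full_or_lower:
  assumes "mat2 a 0 c d \<in> G" "c \<noteq> 0"
  shows "G = {A. invertible A} \<or> G = {A. invertible A \<and> A $ 1 $ 2 = 0}"
proof -
  interpret T: torus_submonoid "transpose ` G"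
    by (rule transposed)
  have "mat2 a c 0 d = transpose (mat2 a 0 c d)"
    by (simp add: mat2_eq_iff transpose_def)
  then have "mat2 a c 0 d \<in> transpose ` G"
    using assms(1) by blast
  from T.full_or_upper[OF this assms(2)]
  have "transpose ` transpose ` G = transpose ` {A. invertible A} \<or>
    transpose ` transpose ` G = transpose ` {A. invertible A \<and> A $ 2 $ 1 = 0}"
    by auto
  moreover have "transpose ` transpose ` G = G"
    by (auto simp: image_image)
  moreover have "transpose ` {A :: 'a^2^2. invertible A} = {A. invertible A}"
    by (auto simp: invertible_det_nz intro!: image_eqI[of _ _ "transpose _"])
  moreover have "transpose ` {A :: 'a^2^2. invertible A \<and> A $ 2 $ 1 = 0} = {A. invertible A \<and> A $ 1 $ 2 = 0}"
  proof -
    have nth: "transpose A $ i $ j = A $ j $ i" for A :: "'a^2^2" and i j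
      by (simp add: transpose_def)
    show ?thesis
      by (auto simp: invertible_det_nz nth intro!: image_eqI[of _ _ "transpose _"])
  qed
  ultimately show ?thesis by simp
qed

text \<open>
  The torus acts on both sides of a matrix by rescaling rows and columns, under which only the
  cross ratio of the entries is invariant. Two elements with different cross ratios can therefore be
  combined to a nontrivial triangular matrix.
\<close>

lemma full_if_cross_ratios_differ:
  assumes "mat2 a b c d \<in> G" "mat2 a' b' c' d' \<in> G"
    and nz: "b \<noteq> 0" "c \<noteq> 0" "b' \<noteq> 0" "c' \<noteq> 0" "d \<noteq> 0" "a' \<noteq> 0"
    and ne: "a * d * (b' * c') \<noteq> a' * d' * (b * c)"
  shows "G = {A. invertible A}"
proof -
  \<comment> \<open>\<open>t\<close> makes the lower left entry of the product vanish; its upper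
    right entry is then nonzero because the cross ratios differ.\<close>
  define t where "t = - d * c' / (c * a')"
  have "mat2 a b c d ** mat2 t 0 0 1 ** mat2 a' b' c' d' \<in> G"
    using assms by (intro mult diag) (auto simp: t_def)
  moreover have "c * t * a' + d * c' = 0"
    using nz by (simp add: t_def)
  ultimately have "mat2 (a * t * a' + b * c') (a * t * b' + b * d') 0 (c * t * b' + d * d') \<in> G"
    by (simp add: mat2_mult)
  moreover have "a * t * b' + b * d' \<noteq> 0"
    using nz ne by (simp add: t_def field_simps)
  ultimately show ?thesis
    using upper_triangular full_if_upper[OF _ assms(1)] nz by auto
qed

end

text \<open>Let \<open>e\<close> be the rank one idempotent with rows \<open>(u, v)\<close> and
  \<open>(y, 1 - u)\<close>. The matrices assumed to lie in \<open>G\<close> are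
  \<open>s e + (1 - e)\<close>, elements of a second torus, and \<open>v\<close> or \<open>y\<close>
  being nonzero says that this torus is not the diagonal one.\<close>

lemma torus_submonoid_trichotomy:
  fixes G :: "(complex^2^2) set"
  assumes "torus_submonoid G"
    and e: "u * (1 - u) = v * y" "v \<noteq> 0 \<or> y \<noteq> 0"
    and G: "\<And>s. s \<in> {2, 3, 4} \<Longrightarrow>
      mat2 (1 + (s - 1) * u) ((s - 1) * v) ((s - 1) * y) (1 + (s - 1) * (1 - u)) \<in> G"
  shows "G = {A. invertible A} \<or> G = {A. invertible A \<and> A $ 2 $ 1 = 0}
    \<or> G = {A. invertible A \<and> A $ 1 $ 2 = 0}"
proof -
  interpret torus_submonoid G by fact
  show ?thesis
  proof (cases "v = 0 \<or> y = 0")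
    case True
    then show ?thesis
    proof
      assume "y = 0"
      then show ?thesis using full_or_upper[of "1 + u" v "1 + (1 - u)"] G[of 2] e by auto
    next
      assume "v = 0"
      then show ?thesis using full_or_lower[of "1 + u" y "1 + (1 - u)"] G[of 2] e by auto
    qed
  next
    case False
    \<comment> \<open>\<open>ok s\<close> says that neither diagonal entry of the matrix for
      \<open>s\<close> vanishes; the next fact computes their product.\<close>
    define ok where "ok s \<longleftrightarrow> s + (s - 1)^2 * (v * y) \<noteq> 0" for s :: complex
    have ad: "(1 + (s - 1) * u) * (1 + (s - 1) * (1 - u)) = s + (s - 1)^2 * (v * y)" for s
      unfolding e(1)[symmetric] by (simp add: algebra_simps power2_eq_square)
    \<comment> \<open>In the last condition the two sides differ by
      \<open>(t - s) * (s * t - 1)\<close>, so it holds for any two distinct values among 2, 3,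
      4.\<close>
    have *: ?thesis if "ok s" "ok t" "s \<in> {2, 3, 4}" "t \<in> {2, 3, 4}" "s * (t - 1)^2 \<noteq> t * (s - 1)^2" for s t
    proof -
      have "G = {A. invertible A}"
      proof (rule full_if_cross_ratios_differ[OF G[OF that(3)] G[OF that(4)]])
        show "1 + (s - 1) * (1 - u) \<noteq> 0"
          using \<open>ok s\<close> ad[of s] by (auto simp: ok_def)
        show "1 + (t - 1) * u \<noteq> 0"
          using \<open>ok t\<close> ad[of t] by (auto simp: ok_def)
        have "(s + (s - 1)^2 * (v * y)) * ((t - 1)^2 * (v * y)) \<noteq> (t + (t - 1)^2 * (v * y)) * ((s - 1)^2 * (v * y))"
          using that(5) False by (simp add: algebra_simps)
        then show "(1 + (s - 1) * u) * (1 + (s - 1) * (1 - u)) * ((t - 1) * v * ((t - 1) * y)) \<noteq>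
          (1 + (t - 1) * u) * (1 + (t - 1) * (1 - u)) * ((s - 1) * v * ((s - 1) * y))"
          unfolding ad by (simp add: power2_eq_square mult_ac)
      qed (use that False in auto)
      then show ?thesis by blast
    qed
    have "ok 2 \<and> ok 3 \<or> ok 2 \<and> ok 4 \<or> ok 3 \<and> ok 4"
    proof -
      \<comment> \<open>Each \<open>s\<close> fails only for \<open>v * y = - s / (s - 1)^2\<close>.
        The three values are distinct, so at most one \<open>s\<close> fails.\<close>
      have "\<not> ok 2 \<Longrightarrow> v * y = -2" "\<not> ok 3 \<Longrightarrow> v * y = -3/4" "\<not> ok 4 \<Longrightarrow> v * y = -4/9"
        by (simp_all add: ok_def eq_neg_iff_add_eq_0 field_simps)
      then show ?thesis
        by (cases "ok 2"; cases "ok 3"; cases "ok 4") auto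
    qed
    then show ?thesis
      using *[of 2 3] *[of 2 4] *[of 3 4] by auto
  qed
qed


section \<open>Unipotent matrices and reductive groups\<close>

lemma unipotent_mat2D:
  assumes "unipotent_matrix (mat 1 + N)"
  shows "det N = 0" "N $ 2 $ 2 = - N $ 1 $ (1::2)"
proof -
  obtain m where m: "(((**) N) ^^ m) (mat 1) = 0"
    using assms by (auto simp: unipotent_matrix_def)
  have "det ((((**) N) ^^ k) (mat 1)) = det N ^ k" for k
    by (induction k) (auto simp: det_mul)
  from this[of m] m show det: "det N = 0"
    by (simp add: det_2 mat2_eq_iff split: if_splits)
  obtain a b c d where N: "N = mat2 a b c d" by (rule mat2_cases)
  have ad: "a * d = b * c"
    using det by (simp add: N det_mat2)
  \<comment> \<open>By Cayley-Hamilton a matrix of determinant zero squares to its trace times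
    itself, so one of its powers can vanish only if its trace is zero.\<close>
  have *: "((**) N ^^ Suc k) (mat 1) = mat ((a + d) ^ k) ** N" for k
  proof (induction k)
    case (Suc k)
    have "N ** N = mat (a + d) ** N"
      using ad by (simp add: N mat_mat2 mat2_mult algebra_simps)
    then have "N ** (mat ((a + d) ^ k) ** N) = mat ((a + d) ^ k) ** mat (a + d) ** N"
      by (metis matrix_mul_assoc mult_mat_commute)
    also have "mat ((a + d) ^ k) ** mat (a + d) = (mat ((a + d) ^ Suc k) :: complex^2^2)"
      by (simp add: mat_mat2 mat2_mult)
    finally show ?case using Suc.IH by simp
  qed simp
  have "m \<noteq> 0"
    using m by (auto intro!: gr0I simp: mat2_eq_iff mat_def)
  then obtain k where "m = Suc k"
    using not0_implies_Suc by blast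
  with * m have "mat ((a + d) ^ k) ** N = 0"
    by simp
  then have "a + d = 0"
    by (auto simp: N mat_mat2 mat2_mult zero_mat2)
  then show "N $ 2 $ 2 = - N $ 1 $ 1"
    by (simp add: N eq_neg_iff_add_eq_0 add.commute)
qed

lemma GL_simps [simp]:
  "carrier (GL k) = {A. invertible A}" "A \<otimes>\<^bsub>GL k\<^esub> B = A ** B" "\<one>\<^bsub>GL k\<^esub> = mat 1"
  by (simp_all add: GL_def)

lemma reductive_if_no_unipotents:
  assumes "\<And>u. u \<in> M \<Longrightarrow> unipotent_matrix u \<Longrightarrow> u = mat 1"
  shows "reductive M"
  unfolding reductive_def
proof (intro allI impI)
  fix U
  assume U: "alg_subgroup U (GL UNIV) \<and> U \<lhd> (GL UNIV)\<lparr>carrier := M\<rparr> \<and>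
    zariski_connected (GL UNIV) U \<and> (\<forall>u\<in>U. unipotent_matrix u)"
  then have "subgroup U ((GL UNIV)\<lparr>carrier := M\<rparr>)"
    by (simp add: normal_def)
  then have "U \<subseteq> M" "mat 1 \<in> U"
    using subgroup.subset[of U] subgroup.one_closed[of U] by force+
  with U assms show "U = {mat 1}"
    by blast
qed

lemma matrix_inv_mult: "invertible A \<Longrightarrow> A ** matrix_inv A = mat 1" "invertible A \<Longrightarrow> matrix_inv A ** A = mat 1"
  for A :: "'a::semiring_1^'n^'m"
  unfolding invertible_def matrix_inv_def by (rule someI2_ex; simp)+

lemma inv_GL: "invertible A \<Longrightarrow> inv\<^bsub>GL k\<^esub> A = matrix_inv A"
  by (rule group.inv_equality[OF group_GL])
    (use matrix_inv_mult[of A] in \<open>auto simp: invertible_def\<close>)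

text \<open>
  If \<open>1 + N\<close> is a unipotent element of a normal unipotent subgroup, so is its product with a conjugate,
  whose trace is \<open>2 + tr (N W N W\<inverse>)\<close>; for a suitable \<open>W\<close> this differs from \<open>2\<close> unless \<open>N = 0\<close>.
\<close>

lemma reductive_GL: "reductive {A :: complex^2^2. invertible A}"
  unfolding reductive_def
proof (intro allI impI)
  fix U :: "(complex^2^2) set"
  assume U: "alg_subgroup U (GL UNIV) \<and> U \<lhd> (GL UNIV)\<lparr>carrier := {A. invertible A}\<rparr> \<and>
    zariski_connected (GL UNIV) U \<and> (\<forall>u\<in>U. unipotent_matrix u)"
  have "(GL UNIV)\<lparr>carrier := {A. invertible A}\<rparr> = (GL UNIV :: (complex^2^2) alg_group)"
    by (simp add: GL_def)
  with U have normal: "U \<lhd> (GL UNIV :: (complex^2^2) alg_group)"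
    by simp
  then have sub: "subgroup U (GL UNIV)"
    by (simp add: normal_def)
  have "u = mat 1" if u: "u \<in> U" for u
  proof -
    obtain p q r s where N: "u - mat 1 = mat2 p q r s" by (rule mat2_cases)
    then have u_eq: "u = mat 1 + mat2 p q r s"
      by (simp add: algebra_simps)
    have "unipotent_matrix (mat 1 + mat2 p q r s)"
      using u U u_eq by blast
    from unipotent_mat2D[OF this] have s: "s = - p" and pq: "- p * p - q * r = 0"
      by (auto simp: det_mat2)
    \<comment> \<open>A conjugate of \<open>u\<close> times \<open>u\<close> lies in
      \<open>U\<close> by normality, hence is unipotent and has trace 2; the sum is this trace
      written out.\<close>
    have tr: "(w ** u ** w')$1$1 * u$1$1 + (w ** u ** w')$1$2 * u$2$1 + (w ** u ** w')$2$1 * u$1$2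
        + (w ** u ** w')$2$2 * u$2$2 = 2"
      if "w ** w' = mat 1" "w' ** w = mat 1" for w w' :: "complex^2^2"
    proof -
      have "w \<in> carrier (GL UNIV)"
        using that by (auto simp: invertible_def)
      then have "w ** u ** inv\<^bsub>GL UNIV\<^esub> w \<in> U"
        using normal u by (metis GL_simps(2) normal.inv_op_closed2)
      moreover have "inv\<^bsub>GL UNIV\<^esub> w = w'"
        by (rule group.inv_equality[OF group_GL]) (use that in \<open>auto simp: invertible_def\<close>)
      ultimately have "(w ** u ** w') ** u \<in> U"
        using subgroup.m_closed[OF sub] u by force
      then have "unipotent_matrix (mat 1 + ((w ** u ** w') ** u - mat 1))"
        using U by simp
      from unipotent_mat2D(2)[OF this] show ?thesis
        by (simp add: matrix_matrix_mult_def[of "w ** u ** w'"] sum_2 mat_def algebra_simps)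
    qed
    \<comment> \<open>The reflection gives \<open>2 * p * p - 2 * q * r = 0\<close>, hence
      \<open>4 * p * p = 0\<close> as \<open>p * p = - q * r\<close>. Afterwards the swap of
      coordinates gives \<open>q * q + r * r = 0\<close>, while \<open>q * r = 0\<close>.\<close>
    have "p = 0"
      using tr[of "mat2 1 0 0 (-1)" "mat2 1 0 0 (-1)"] pq
      by (auto simp: u_eq s mat2_mult mat_mat2 mat2_add algebra_simps power2_eq_square) 
    have "q * q + r * r = 0"
      using tr[of "mat2 0 1 1 0" "mat2 0 1 1 0"] \<open>p = 0\<close>
      by (simp add: u_eq s mat2_mult mat_mat2 mat2_add add.commute)
    then have "q = 0" "r = 0"
      using pq \<open>p = 0\<close> by auto
    with \<open>p = 0\<close> show ?thesis
      unfolding u_eq s by (simp add: mat2_eq_iff)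
  qed
  moreover have "mat 1 \<in> U"
    using subgroup.one_closed[OF sub] by simp
  ultimately show "U = {mat 1}"
    by blast
qed

section \<open>Groups normalizing a line of nilpotent matrices\<close>

lemma generated_algebra_polynomial:
  assumes "f \<in> generated_algebra k S" "\<And>g. g \<in> S \<Longrightarrow> \<exists>p. \<forall>x. g (\<phi> x) = poly p x"
  shows "\<exists>p. \<forall>x. f (\<phi> x) = poly p x"
  using assms(1)
proof induction
  case (const c)
  show ?case by (rule exI[of _ "[:c:]"]) simp
next
  case (gen f)
  then show ?case by (rule assms(2))
next
  case (add f g)
  then show ?case by (metis poly_add)
next
  case (mult f g)
  then show ?case by (metis poly_mult)
qed

text \<open>The matrices \<open>1 + x N\<close> form a copy of the additive group: closed, connected
  and unipotent. The last hypothesis is \<open>A N A\<inverse> = c N\<close> written without an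
  inverse, and makes this copy normal in \<open>M\<close>.\<close>

lemma not_reductive_if_normalizes_nilpotent:
  fixes N :: "complex^2^2"
  assumes M: "subgroup M (GL UNIV)"
    and N: "N ** N = 0" "N \<noteq> 0"
    and N_in: "\<And>x. mat 1 + mat x ** N \<in> M"
    and norm: "\<And>A. A \<in> M \<Longrightarrow> \<exists>c. A ** N = mat c ** N ** A"
  shows "\<not> reductive M"
proof
  assume red: "reductive M"
  define u where "u x = mat 1 + mat x ** N" for x
  define U where "U = range u"
  have u_mult: "u x ** u y = u (x + y)" for x y
  proof -
    have "mat x ** N ** (mat y ** N) = mat x ** mat y ** (N ** N)"
      by (metis matrix_mul_assoc mult_mat_commute)
    then show ?thesis
      by (simp add: u_def N matrix_add_ldistrib matrix_add_rdistrib vec_eq_iff algebra_simps)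
  qed
  have u0: "u 0 = mat 1"
    by (simp add: u_def vec_eq_iff)
  have u_inv: "invertible (u x)" for x
    unfolding invertible_def using u_mult[of x "-x"] u_mult[of "-x" x] u0 by auto
  have M_inv: "invertible A" if "A \<in> M" for A
    using subgroup.subset[OF M] that by auto
  obtain i j where ij: "N $ i $ j \<noteq> 0"
    using N(2) by (auto simp: vec_eq_iff)
  have sub: "subgroup U (GL UNIV)"
  proof (rule group.subgroupI[OF group_GL])
    fix A assume "A \<in> U"
    then obtain x where A: "A = u x" by (auto simp: U_def)
    have "inv\<^bsub>GL UNIV\<^esub> A = u (- x)"
      by (rule group.inv_equality[OF group_GL]) (auto simp: A u_mult u0 u_inv)
    then show "inv\<^bsub>GL UNIV\<^esub> A \<in> U"
      by (simp add: U_def)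
  qed (auto simp: U_def u_mult u_inv)
  \<comment> \<open>These functions say that \<open>A - 1\<close> is proportional to
    \<open>N\<close>, by comparison with the fixed nonzero entry of \<open>N\<close> at
    \<open>i\<close>, \<open>j\<close>.\<close>
  define F where "F = {\<lambda>A. (A $ k $ l + - (mat 1 $ k $ l)) * N $ i $ j
    + (A $ i $ j + - (mat 1 $ i $ j)) * (- N $ k $ l) | k l. True}"
  have closed: "zariski_closed (GL UNIV) U"
    unfolding zariski_closed_def
  proof (intro exI[of _ F] conjI)
    show "F \<subseteq> regular (GL UNIV)"
    proof -
      have entry: "(\<lambda>A. A $ k $ l) \<in> regular (GL UNIV)" for k l :: 2
        unfolding GL_def alg_group.simps by (rule generated_algebra.gen) blast
      have const: "(\<lambda>A. c) \<in> regular (GL UNIV :: (complex^2^2) alg_group)" for c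
        unfolding GL_def alg_group.simps by (rule generated_algebra.const) simp
      have add: "(\<lambda>A. f A + g A) \<in> regular (GL UNIV)" and mult: "(\<lambda>A. f A * g A) \<in> regular (GL UNIV)"
        if "f \<in> regular (GL UNIV)" "g \<in> regular (GL UNIV)" for f g :: "complex^2^2 \<Rightarrow> complex"
        using that unfolding GL_def alg_group.simps
        by (rule generated_algebra.add, rule generated_algebra.mult)
      show ?thesis
        unfolding F_def by clarify (intro add mult entry const)
    qed
    show "U = {A \<in> carrier (GL UNIV). \<forall>f\<in>F. f A = 0}"
    proof (intro equalityI subsetI)
      fix A assume "A \<in> {A \<in> carrier (GL UNIV). \<forall>f\<in>F. f A = 0}"
      then have F0: "f A = 0" if "f \<in> F" for f
        using that by blast
      have "(A $ k $ l + - (mat 1 $ k $ l)) * N $ i $ j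
        + (A $ i $ j + - (mat 1 $ i $ j)) * (- N $ k $ l) = 0" for k l
        by (rule F0) (auto simp: F_def)
      then have "A = u ((A $ i $ j - mat 1 $ i $ j) / N $ i $ j)"
        using ij by (auto simp: u_def vec_eq_iff field_simps)
      then show "A \<in> U"
        unfolding U_def by blast
    qed (use u_inv in \<open>auto simp: U_def F_def\<close>, simp add: u_def)
  qed
  have grp: "group ((GL UNIV)\<lparr>carrier := M\<rparr>)"
    by (rule subgroup.subgroup_is_group[OF M group_GL])
  have "U \<subseteq> M"
    using N_in by (auto simp: U_def u_def)
  have normal: "U \<lhd> (GL UNIV)\<lparr>carrier := M\<rparr>"
    unfolding group.normal_inv_iff[OF grp]
  proof (intro conjI ballI)
    show "subgroup U ((GL UNIV)\<lparr>carrier := M\<rparr>)"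
      by (rule group.subgroup_incl[OF group_GL sub M \<open>U \<subseteq> M\<close>])
    fix A B assume "A \<in> carrier ((GL UNIV)\<lparr>carrier := M\<rparr>)" "B \<in> U"
    then have A: "A \<in> M" and "\<exists>x. B = u x"
      by (auto simp: U_def)
    then obtain x where B: "B = u x" by blast
    obtain c where c: "A ** N = mat c ** N ** A"
      using norm[OF A] by blast
    have "inv\<^bsub>(GL UNIV)\<lparr>carrier := M\<rparr>\<^esub> A = matrix_inv A"
      using group.m_inv_consistent[OF group_GL M A] inv_GL[OF M_inv[OF A]] by simp
    moreover have "A ** u x ** matrix_inv A = u (x * c)"
    proof -
      have "A ** u x = A + mat x ** (A ** N)"
        by (simp add: u_def matrix_add_ldistrib) (metis matrix_mul_assoc mult_mat_commute)
      also have "\<dots> = A + mat (x * c) ** N ** A"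
        by (simp add: c matrix_mul_assoc) (simp add: vec_eq_iff flip: matrix_mul_assoc)
      also have "\<dots> = u (x * c) ** A"
        by (simp add: u_def matrix_add_rdistrib)
      finally show ?thesis
        using matrix_inv_mult(1)[OF M_inv[OF A]] by (simp flip: matrix_mul_assoc)
    qed
    ultimately show "A \<otimes>\<^bsub>(GL UNIV)\<lparr>carrier := M\<rparr>\<^esub> B \<otimes>\<^bsub>(GL UNIV)\<lparr>carrier := M\<rparr>\<^esub>
        inv\<^bsub>(GL UNIV)\<lparr>carrier := M\<rparr>\<^esub> A \<in> U"
      by (simp add: B U_def)
  qed
  have poly: "\<exists>p. \<forall>x. f (u x) = poly p x" if "f \<in> regular (GL UNIV)" for f
  proof -
    obtain a b c d where N': "N = mat2 a b c d" by (rule mat2_cases)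
    have "unipotent_matrix (mat 1 + N)"
      unfolding unipotent_matrix_def by (rule exI[of _ 2]) (simp add: numeral_2_eq_2 N)
    from unipotent_mat2D[OF this] have d: "d = - a" "a * d - b * c = 0"
      by (auto simp: N' det_mat2)
    have "det (u x) = 1 + x * (a + d) + x^2 * (a * d - b * c)" for x
      by (simp add: u_def N' mat_mat2 mat2_mult mat2_add det_mat2 algebra_simps power2_eq_square)
    \<comment> \<open>So the generator \<open>inverse (det A)\<close> restricts to a constant and
      regular functions on \<open>U\<close> are polynomials in \<open>x\<close>, without
      denominators.\<close>
    then have "det (u x) = 1" for x
      using d by simp
    moreover have "\<exists>p. \<forall>x. u x $ k $ l = poly p x" for k l
      by (rule exI[of _ "[:mat 1 $ k $ l, N $ k $ l:]"]) (simp add: u_def)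
    ultimately show ?thesis
      using that unfolding GL_def alg_group.simps
      by (elim generated_algebra_polynomial) (auto intro: exI[of _ 1])
  qed
  have connected: "zariski_connected (GL UNIV) U"
    unfolding zariski_connected_def
  proof (rule notI, elim exE conjE)
    fix A B
    assume A: "zariski_closed (GL UNIV) A" and B: "zariski_closed (GL UNIV) B"
      and "A \<noteq> {}" "B \<noteq> {}" and disj: "A \<inter> B = {}" and U: "U = A \<union> B"
    obtain FA where FA: "FA \<subseteq> regular (GL UNIV)" "A = {x \<in> carrier (GL UNIV). \<forall>f\<in>FA. f x = 0}"
      using A by (auto simp: zariski_closed_def)
    obtain FB where FB: "FB \<subseteq> regular (GL UNIV)" "B = {x \<in> carrier (GL UNIV). \<forall>f\<in>FB. f x = 0}"
      using B by (auto simp: zariski_closed_def)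
    obtain a b where "u a \<in> A" "u b \<in> B"
      using \<open>A \<noteq> {}\<close> \<open>B \<noteq> {}\<close> U by (auto simp: U_def) (metis Un_iff ex_in_conv rangeE)
    then have "u a \<notin> B" "u b \<notin> A"
      using disj by auto
    then obtain f g where f: "f \<in> FA" "f (u b) \<noteq> 0" and g: "g \<in> FB" "g (u a) \<noteq> 0"
      using FA FB u_inv by auto
    obtain p q where p: "\<And>x. f (u x) = poly p x" and q: "\<And>x. g (u x) = poly q x"
      using poly f g FA FB by (meson subsetD)
    \<comment> \<open>The affine line is irreducible: a product of polynomials that vanishes
      everywhere has a vanishing factor.\<close>
    have "poly (p * q) x = 0" for x
    proof -
      have "u x \<in> A \<union> B"
        using U by (auto simp: U_def)
      then have "f (u x) = 0 \<or> g (u x) = 0"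
        using f g FA FB by auto
      then show ?thesis
        by (simp add: p q)
    qed
    then have "p * q = 0"
      using poly_all_0_iff_0 by blast
    with p q f g show False
      by auto
  qed
  have unip: "\<forall>A\<in>U. unipotent_matrix A"
  proof
    fix A assume "A \<in> U"
    then obtain x where A: "A = u x" by (auto simp: U_def)
    have "(A - mat 1) ** (A - mat 1) = 0"
    proof -
      have "mat x ** N ** (mat x ** N) = mat x ** (mat x ** (N ** N))"
        by (metis matrix_mul_assoc mult_mat_commute)
      then show ?thesis
        by (simp add: A u_def N vec_eq_iff)
    qed
    then show "unipotent_matrix A"
      unfolding unipotent_matrix_def by (intro exI[of _ 2]) (simp add: numeral_2_eq_2)
  qed
  have "U = {mat 1}"
    using red sub closed normal connected unip by (simp add: reductive_def alg_subgroup_def)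
  then have "u 1 = mat 1"
    by (auto simp: U_def)
  with N(2) show False
    by (simp add: u_def)
qed

section \<open>Zariski density of the real points of the torus\<close>

text \<open>A Laurent polynomial is represented by a polynomial and a power of \<open>x\<close> that
  clears the denominators, a shape stable under sums and products.\<close>

lemma generated_algebra_Laurent:
  assumes "f \<in> generated_algebra k S"
    and "\<And>g. g \<in> S \<Longrightarrow> \<exists>n p. \<forall>x::complex. x \<noteq> 0 \<longrightarrow> x ^ n * g (\<phi> x) = poly p x"
  shows "\<exists>n p. \<forall>x. x \<noteq> 0 \<longrightarrow> x ^ n * f (\<phi> x) = poly p x"
  using assms(1)
proof induction
  case (const c)
  show ?case by (intro exI[of _ 0] exI[of _ "[:c:]"]) simp
next
  case (gen f)
  then show ?case by (rule assms(2))
next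
  case (add f g)
  then obtain m p n q where p: "\<And>x. x \<noteq> 0 \<Longrightarrow> x ^ m * f (\<phi> x) = poly p x"
    and q: "\<And>x. x \<noteq> 0 \<Longrightarrow> x ^ n * g (\<phi> x) = poly q x"
    by blast
  show ?case
  proof (intro exI[of _ "m + n"] exI[of _ "monom 1 n * p + monom 1 m * q"] allI impI)
    fix x :: complex assume "x \<noteq> 0"
    then show "x ^ (m + n) * (f (\<phi> x) + g (\<phi> x)) = poly (monom 1 n * p + monom 1 m * q) x"
      by (simp add: poly_monom power_add algebra_simps flip: p q)
  qed
next
  case (mult f g)
  then obtain m p n q where p: "\<And>x. x \<noteq> 0 \<Longrightarrow> x ^ m * f (\<phi> x) = poly p x"
    and q: "\<And>x. x \<noteq> 0 \<Longrightarrow> x ^ n * g (\<phi> x) = poly q x"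
    by blast
  show ?case
  proof (intro exI[of _ "m + n"] exI[of _ "p * q"] allI impI)
    fix x :: complex assume "x \<noteq> 0"
    then show "x ^ (m + n) * (f (\<phi> x) * g (\<phi> x)) = poly (p * q) x"
      by (simp add: power_add flip: p q)
  qed
qed

lemma Laurent_zero:
  fixes f :: "complex \<Rightarrow> complex"
  assumes "\<exists>n p. \<forall>x. x \<noteq> 0 \<longrightarrow> x ^ n * f x = poly p x"
    and "\<And>m. f (of_nat (Suc m)) = 0" "x \<noteq> 0"
  shows "f x = 0"
proof -
  obtain n p where p: "\<And>x. x \<noteq> 0 \<Longrightarrow> x ^ n * f x = poly p x"
    using assms(1) by blast
  have "poly p (of_nat (Suc m)) = 0" for m
    using p[of "of_nat (Suc m)"] assms(2)[of m] by (simp del: of_nat_Suc)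
  then have "range (\<lambda>m. of_nat (Suc m)) \<subseteq> {x. poly p x = 0}"
    by auto
  moreover have "infinite (range (\<lambda>m. of_nat (Suc m) :: complex))"
    by (intro range_inj_infinite injI) (simp del: of_nat_Suc)
  ultimately have "p = 0"
    using poly_roots_finite finite_subset by blast
  with p[OF assms(3)] assms(3) show ?thesis by simp
qed

text \<open>Freezing one coordinate leaves a Laurent polynomial in the other, which cannot have
  infinitely many zeros unless it vanishes. The first coordinate is freed while the second is still
  an integer.\<close>

lemma regular_Gm2_zero:
  assumes "\<psi> \<in> regular (Gm2 k)" "\<And>m n. \<psi> (of_nat (Suc m), of_nat (Suc n)) = 0" "x \<noteq> 0" "y \<noteq> 0"
  shows "\<psi> (x, y) = 0"
proof -
  have const: "\<exists>n p. \<forall>x::complex. x \<noteq> 0 \<longrightarrow> x ^ n * c = poly p x" for c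
    by (intro exI[of _ 0] exI[of _ "[:c:]"]) simp
  have var: "\<exists>n p. \<forall>x::complex. x \<noteq> 0 \<longrightarrow> x ^ n * x = poly p x"
    by (intro exI[of _ 0] exI[of _ "[:0, 1:]"]) simp
  have invvar: "\<exists>n p. \<forall>x::complex. x \<noteq> 0 \<longrightarrow> x ^ n * inverse x = poly p x"
    by (intro exI[of _ 1] exI[of _ "1"]) simp
  have \<psi>: "\<psi> \<in> generated_algebra k {fst, snd, \<lambda>p. inverse (fst p), \<lambda>p. inverse (snd p)}"
    using assms(1) by (simp add: Gm2_def)
  have x: "\<psi> (x, of_nat (Suc n)) = 0" for n
  proof (rule Laurent_zero[where f = "\<lambda>x. \<psi> (x, of_nat (Suc n))"])
    show "\<exists>m p. \<forall>x. x \<noteq> 0 \<longrightarrow> x ^ m * \<psi> (x, of_nat (Suc n)) = poly p x"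
      by (rule generated_algebra_Laurent[OF \<psi>], elim insertE emptyE; hypsubst)
        (simp only: fst_conv snd_conv; rule const var invvar)+
  qed (use assms in auto)
  show ?thesis
  proof (rule Laurent_zero[where f = "\<lambda>y. \<psi> (x, y)"])
    show "\<exists>m p. \<forall>y. y \<noteq> 0 \<longrightarrow> y ^ m * \<psi> (x, y) = poly p y"
      by (rule generated_algebra_Laurent[OF \<psi>], elim insertE emptyE; hypsubst)
        (simp only: fst_conv snd_conv; rule const var invvar)+
  qed (use x assms in auto)
qed

lemma points_Gm2: "points \<real> (Gm2 \<real>) = {(x, y). x \<in> \<real> \<and> y \<in> \<real> \<and> x \<noteq> 0 \<and> y \<noteq> 0}"
proof -
  have "f (x, y) \<in> \<real>" if "f \<in> regular (Gm2 \<real>)" "x \<in> \<real>" "y \<in> \<real>" for f x y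
    using that(1) unfolding Gm2_def alg_group.simps
    by induction (use that in auto)
  moreover have "x \<in> \<real> \<and> y \<in> \<real>" if "\<forall>f\<in>regular (Gm2 \<real>). f (x, y) \<in> \<real>" for x y
    using bspec[OF that, of fst] bspec[OF that, of snd]
    by (auto simp: Gm2_def intro: generated_algebra.gen)
  moreover have "carrier (Gm2 \<real>) = {(x, y). x \<noteq> 0 \<and> y \<noteq> 0}"
    by (simp add: Gm2_def)
  ultimately show ?thesis
    unfolding points_def by blast
qed

lemma regular_GL_mono: "k \<subseteq> k' \<Longrightarrow> regular (GL k) \<subseteq> regular (GL k')"
  by (simp add: GL_def generated_algebra_mono)

lemma Rats_subset_Reals: "\<rat> \<subseteq> (\<real> :: complex set)"
  by (metis Rats_cases' Reals_divide Reals_of_int subsetI)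

text \<open>The equations of \<open>M\<close> pull back along \<open>h\<close> to regular functions
  on the torus. They vanish at pairs of positive integers, since these are real points and
  \<open>h\<close> maps them into \<open>BMT h\<close>.\<close>

lemma torus_subset:
  assumes "h \<in> X_h0" "alg_subgroup M (GL \<rat>)" "BMT h \<subseteq> M" "x \<noteq> 0" "y \<noteq> 0"
  shows "h (x, y) \<in> M"
proof -
  obtain F where F: "F \<subseteq> regular (GL \<rat>)" "M = {A \<in> carrier (GL \<rat>). \<forall>f\<in>F. f A = 0}"
    using assms(2) by (auto simp: alg_subgroup_def zariski_closed_def)
  have hom: "h \<in> alg_hom (Gm2 \<real>) (GL \<real>)"
    using assms(1) X_h0_subset_alg_hom by blast
  have carrier: "(u, v) \<in> carrier (Gm2 \<real>)" if "u \<noteq> 0" "v \<noteq> 0" for u v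
    using that by (simp add: Gm2_def)
  have "h (x, y) \<in> carrier (GL \<rat>)"
    using hom carrier[OF assms(4,5)] by (auto simp: alg_hom_def hom_def)
  moreover have "f (h (x, y)) = 0" if f: "f \<in> F" for f
  proof -
    have "f \<in> regular (GL \<real>)"
      using f F regular_GL_mono[OF Rats_subset_Reals] by blast
    then obtain \<psi> where \<psi>: "\<psi> \<in> regular (Gm2 \<real>)" "\<And>p. p \<in> carrier (Gm2 \<real>) \<Longrightarrow> f (h p) = \<psi> p"
      using hom unfolding alg_hom_def by blast
    have "\<psi> (of_nat (Suc m), of_nat (Suc n)) = 0" for m n
    proof -
      have "(of_nat (Suc m), of_nat (Suc n)) \<in> points \<real> (Gm2 \<real>)"
        by (auto simp: points_Gm2 simp del: of_nat_Suc)
      then have "h (of_nat (Suc m), of_nat (Suc n)) \<in> BMT h"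
        using BMT_smallest(1)[OF assms(1)] by (auto simp: points_def)
      then have "f (h (of_nat (Suc m), of_nat (Suc n))) = 0"
        using f F assms(3) by blast
      then show ?thesis
        using \<psi>(2)[OF carrier] by (simp del: of_nat_Suc)
    qed
    then have "\<psi> (x, y) = 0"
      by (rule regular_Gm2_zero[OF \<psi>(1) _ assms(4,5)])
    then show ?thesis
      using \<psi>(2)[OF carrier[OF assms(4,5)]] by simp
  qed
  ultimately show ?thesis
    using F by blast
qed


section \<open>The generic case\<close>

text \<open>The equations of \<open>M\<close> have rational coefficients, and evaluating such a
  function at an invertible matrix over \<open>K\<close> commutes with
  \<open>\<sigma>\<close>.\<close>

lemma (in field_embedding) alg_subgroup_embedding_closed:
  assumes M: "alg_subgroup M (GL \<rat>)"
    and A: "mat2 a b c d \<in> M" "a \<in> K" "b \<in> K" "c \<in> K" "d \<in> K"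
  shows "mat2 (\<sigma> a) (\<sigma> b) (\<sigma> c) (\<sigma> d) \<in> M"
proof -
  let ?A = "mat2 a b c d" and ?B = "mat2 (\<sigma> a) (\<sigma> b) (\<sigma> c) (\<sigma> d)"
  obtain F where F: "F \<subseteq> regular (GL \<rat>)" "M = {A \<in> carrier (GL \<rat>). \<forall>f\<in>F. f A = 0}"
    using M by (auto simp: alg_subgroup_def zariski_closed_def)
  have det: "det ?A \<in> K" "det ?B = \<sigma> (det ?A)"
    using A(2-) by (simp_all add: det_mat2 diff_in mult_in hom_diff hom_mult)
  have "det ?A \<noteq> 0"
    using A(1) F(2) by (simp add: invertible_det_nz)
  with det have "?B \<in> carrier (GL \<rat>)"
    by (simp add: invertible_det_nz hom_eq_0)
  moreover have "f ?B = 0" if "f \<in> F" for f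
  proof -
    have "f ?A \<in> K \<and> f ?B = \<sigma> (f ?A)"
      using subsetD[OF F(1) that] unfolding GL_def alg_group.simps
    proof induction
      case (const c)
      then show ?case by (simp add: Rats_in hom_Rats)
    next
      case (gen f)
      then consider "f = (\<lambda>A. inverse (det A))" | i j where "f = (\<lambda>A. A $ i $ j)"
        by blast
      then show ?case
      proof cases
        case 1
        then show ?thesis using det by (simp add: inverse_in hom_inverse)
      next
        case 2
        then show ?thesis
          using A(2-) exhaust_2[of i] exhaust_2[of j] by auto
      qed
    qed (simp_all add: add_in hom_add mult_in hom_mult)
    moreover have "f ?A = 0"
      using A(1) F(2) that by blast
    ultimately show ?thesis
      by (simp add: hom_zero)
  qed
  ultimately show ?thesis
    using F(2) by blast
qed

section \<open>Conjugation to the diagonal torus\<close>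

locale conjugation =
  fixes g g' :: "complex^2^2"
  assumes inverse_right: "g ** g' = mat 1" and inverse_left: "g' ** g = mat 1"
begin

definition conj :: "complex^2^2 \<Rightarrow> complex^2^2" where
  "conj A = g ** A ** g'"

definition unconj :: "complex^2^2 \<Rightarrow> complex^2^2" where
  "unconj A = g' ** A ** g"

lemma conj_mult: "conj (A ** B) = conj A ** conj B"
proof -
  have "conj A ** conj B = g ** A ** (g' ** g) ** B ** g'"
    by (simp add: conj_def matrix_mul_assoc)
  then show ?thesis by (simp add: inverse_left conj_def matrix_mul_assoc)
qed

lemma conj_add: "conj (A + B) = conj A + conj B"
  by (simp add: conj_def matrix_add_ldistrib matrix_add_rdistrib)

lemma conj_mat: "conj (mat c) = mat c"
  by (simp add: conj_def mult_mat_commute flip: matrix_mul_assoc) (simp add: inverse_right mult_mat_commute[of "mat 1", symmetric])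

lemma conj_unconj: "conj (unconj A) = A"
proof -
  have "conj (unconj A) = (g ** g') ** A ** (g ** g')"
    by (simp add: conj_def unconj_def matrix_mul_assoc)
  then show ?thesis by (simp add: inverse_right)
qed

lemma unconj_conj: "unconj (conj A) = A"
proof -
  have "unconj (conj A) = (g' ** g) ** A ** (g' ** g)"
    by (simp add: conj_def unconj_def matrix_mul_assoc)
  then show ?thesis by (simp add: inverse_left)
qed

lemma invertible_unconj: "invertible A \<Longrightarrow> invertible (unconj A)"
  unfolding unconj_def
  by (intro invertible_mult) (use inverse_left inverse_right in \<open>auto simp: invertible_def\<close>)

end

text \<open>The field only selects the regular functions, not the group law. This bridges
  Mumford-Tate groups, defined over the rationals, and reductivity, which is tested over the complex
  numbers.\<close>

lemma subgroup_GL_change_field: "subgroup M (GL k) \<Longrightarrow> subgroup M (GL k')"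
proof -
  assume M: "subgroup M (GL k)"
  have inv: "invertible A" if "A \<in> M" for A
    using subgroup.subset[OF M] that by auto
  show "subgroup M (GL k')"
  proof
    show "x \<otimes>\<^bsub>GL k'\<^esub> y \<in> M" if "x \<in> M" "y \<in> M" for x y
      using subgroup.m_closed[OF M that] by simp
    show "\<one>\<^bsub>GL k'\<^esub> \<in> M"
      using subgroup.one_closed[OF M] by simp
    show "inv\<^bsub>GL k'\<^esub> x \<in> M" if "x \<in> M" for x
      using subgroup.m_inv_closed[OF M that] inv[OF that] by (simp add: inv_GL)
  qed (use inv in auto)
qed

lemma X_h0_cases:
  assumes "h \<in> X_h0"
  obtains g g' where "conjugation g g'" "\<And>p. h p = conjugation.conj g g' (h0 p)"
    "\<And>i j. g $ i $ j \<in> \<real>" "\<And>i j. g' $ i $ j \<in> \<real>"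
proof -
  obtain g where h: "h = conjugate_hom g h0" and g: "g \<in> points \<real> (GL \<real>)"
    using assms by (auto simp: X_h0_def)
  have inv: "invertible g"
    using g by (simp add: points_def)
  have entry: "g $ i $ j \<in> \<real>" for i j
  proof -
    have "(\<lambda>A. A $ i $ j) \<in> regular (GL \<real>)"
      by (auto simp: GL_def intro!: generated_algebra.gen)
    then show ?thesis
      using g by (auto simp: points_def dest: bspec[where x = "\<lambda>A. A $ i $ j"])
  qed
  obtain a b c d where g_eq: "g = mat2 a b c d" by (rule mat2_cases)
  have det: "a * d - b * c \<noteq> 0" "a * d - c * b \<noteq> 0"
    using inv by (simp_all add: g_eq invertible_mat2 mult.commute)
  define D where "D = a * d - b * c"
  define g' where "g' = mat2 (d / D) (- b / D) (- c / D) (a / D)"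
  have conj: "conjugation g g'"
    by unfold_locales (use det in \<open>simp_all add: g_eq g'_def D_def mat2_mult mat_mat2
        mult.commute flip: diff_divide_distrib\<close>)
  have g'_inv: "matrix_inv g = g'"
    using conj matrix_inv_mult[OF inv]
    by (metis conjugation.inverse_right matrix_mul_assoc matrix_mul_lid matrix_mul_rid)
  have "a \<in> \<real>" "b \<in> \<real>" "c \<in> \<real>" "d \<in> \<real>"
    using entry[of 1 1] entry[of 1 2] entry[of 2 1] entry[of 2 2] by (simp_all add: g_eq)
  then have "g' $ i $ j \<in> \<real>" for i j
    using exhaust_2[of i] exhaust_2[of j] by (auto simp: g'_def D_def)
  moreover have "h p = conjugation.conj g g' (h0 p)" for p
    by (simp add: h conjugate_hom_def g'_inv conjugation.conj_def[OF conj])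
  ultimately show ?thesis
    using that conj entry by blast
qed

lemma (in conjugation) reductive_full:
  assumes "h \<in> X_h0" and h: "\<And>p. h p = conj (h0 p)"
    and N: "conj (mat2 1 0 0 (-1)) = mat2 a b c (- a)"
    and z: "z \<in> {a * a, a * b, a * c, b * b, b * c, c * c}" "z \<notin> \<rat>"
    and M: "reductive_containing_BMT h M"
  shows "M = {A. invertible A}"
proof -
  have alg: "alg_subgroup M (GL \<rat>)" and red: "reductive M" and BMT: "BMT h \<subseteq> M"
    using M by (auto simp: reductive_containing_BMT_def)
  then have sub: "subgroup M (GL UNIV)"
    by (auto simp: alg_subgroup_def intro: subgroup_GL_change_field)
  have M_inv: "invertible A" if "A \<in> M" for A
    using subgroup.subset[OF sub] that by auto
  have M_mult: "A ** B \<in> M" if "A \<in> M" "B \<in> M" for A B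
    using subgroup.m_closed[OF sub that] by simp
  have torus: "conj (mat2 x 0 0 y) \<in> M" if "x \<noteq> 0" "y \<noteq> 0" for x y
    using torus_subset[OF assms(1) alg BMT that] by (simp add: h h0_mat2)
  obtain K \<sigma> where "field_embedding K \<sigma>" and K: "insert z {a, b, c} \<subseteq> K" and moved: "\<sigma> z \<noteq> z"
    using embedding_moving_irrational[OF z(2), of "{a, b, c}"] by blast
  interpret field_embedding K \<sigma> by fact
  have abc: "a \<in> K" "b \<in> K" "c \<in> K"
    using K by auto
  \<comment> \<open>This is \<open>\<sigma>\<close> applied to the entries of \<open>N\<close>; it
    is again an involution of trace zero.\<close>
  define N' where "N' = mat2 (\<sigma> a) (\<sigma> b) (\<sigma> c) (- \<sigma> a)"
  have "mat2 a b c (- a) ** mat2 a b c (- a) = mat 1"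
    by (simp add: mat2_mult conj_mat flip: N conj_mult mat_mat2)
  then have "a * a + b * c = 1"
    by (simp add: mat2_mult mat_mat2)
  then have "\<sigma> (a * a + b * c) = \<sigma> 1"
    by simp
  then have sq: "\<sigma> a * \<sigma> a + \<sigma> b * \<sigma> c = 1"
    using abc by (simp add: hom_add hom_mult hom_one mult_in)
  have N'_sq: "N' ** N' = mat 1"
    using sq by (simp add: N'_def mat2_mult mat_mat2 algebra_simps)
  \<comment> \<open>With the idempotent \<open>(1 + N') / 2\<close> of the moved torus, this is its
    element with eigenvalues \<open>s\<close> and 1. It is the image under \<open>\<sigma>\<close>
    of the corresponding element for \<open>N\<close>, because \<open>s\<close> is rational.\<close>
  have N'_in: "mat2 1 0 0 1 + mat ((s - 1) / 2) ** (mat 1 + N') \<in> M" if s: "s \<in> {2, 3, 4}" for s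
  proof -
    have "mat2 s 0 0 1 = mat ((s + 1) / 2) + mat ((s - 1) / 2) ** mat2 1 0 0 (-1)"
      by (simp add: mat_mat2 mat2_mult mat2_add field_simps)
    then have "conj (mat2 s 0 0 1) = mat ((s + 1) / 2) + mat ((s - 1) / 2) ** mat2 a b c (- a)"
      by (simp add: conj_add conj_mult conj_mat N)
    also have "\<dots> = mat2 ((s + 1) / 2 + (s - 1) / 2 * a) ((s - 1) / 2 * b) ((s - 1) / 2 * c) ((s + 1) / 2 - (s - 1) / 2 * a)"
      by (simp add: mat_mat2 mat2_mult mat2_add)
    finally have "\<dots> \<in> M"
      using torus[of s 1] s by auto
    moreover have Q: "(s + 1) / 2 \<in> \<rat>" "(s - 1) / 2 \<in> \<rat>"
      using s by (auto intro!: Rats_divide Rats_add Rats_diff)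
    ultimately have "mat2 (\<sigma> ((s + 1) / 2 + (s - 1) / 2 * a)) (\<sigma> ((s - 1) / 2 * b))
        (\<sigma> ((s - 1) / 2 * c)) (\<sigma> ((s + 1) / 2 - (s - 1) / 2 * a)) \<in> M"
      by (intro alg_subgroup_embedding_closed[OF alg] add_in diff_in mult_in abc Rats_in)
    moreover have "\<sigma> ((s + 1) / 2) = (s + 1) / 2" "\<sigma> ((s - 1) / 2) = (s - 1) / 2"
      by (rule hom_Rats, fact Q)+
    ultimately have "mat2 ((s + 1) / 2 + (s - 1) / 2 * \<sigma> a) ((s - 1) / 2 * \<sigma> b)
        ((s - 1) / 2 * \<sigma> c) ((s + 1) / 2 - (s - 1) / 2 * \<sigma> a) \<in> M"
      using abc Rats_in[OF Q(1)] Rats_in[OF Q(2)] by (simp only: hom_add hom_diff hom_mult mult_in)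
    moreover have "mat2 1 0 0 1 + mat ((s - 1) / 2) ** (mat 1 + N')
        = mat2 ((s + 1) / 2 + (s - 1) / 2 * \<sigma> a) ((s - 1) / 2 * \<sigma> b)
            ((s - 1) / 2 * \<sigma> c) ((s + 1) / 2 - (s - 1) / 2 * \<sigma> a)"
      by (simp add: N'_def mat_mat2 mat2_mult mat2_add field_simps)
    ultimately show ?thesis
      by simp
  qed
  obtain p v y q where uN': "unconj N' = mat2 p v y q" by (rule mat2_cases)
  then have N'_conj: "N' = conj (mat2 p v y q)"
    by (metis conj_unconj)
  have "mat2 p v y q ** mat2 p v y q = mat 1"
    by (metis N'_conj N'_sq conj_mat conj_mult unconj_conj)
  then have sq1: "p * p + v * y = 1" "p * v + v * q = 0" "y * p + q * y = 0" "y * v + q * q = 1"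
    by (auto simp: mat2_mult mat_mat2)
  have off: "v \<noteq> 0 \<or> y \<noteq> 0"
  proof (rule ccontr)
    assume "\<not> (v \<noteq> 0 \<or> y \<noteq> 0)"
    then have 0: "v = 0" "y = 0" by auto
    then have "(p = 1 \<or> p = -1) \<and> (q = 1 \<or> q = -1)"
      using sq1 by (auto simp: square_eq_1_iff)
    with 0 have "mat2 p v y q \<in> {mat 1, mat (-1), mat2 1 0 0 (-1), mat (-1) ** mat2 1 0 0 (-1)}"
      by (auto simp: mat_mat2 mat2_mult)
    then have "N' \<in> {mat 1, mat (-1), mat2 a b c (- a), mat (-1) ** mat2 a b c (- a)}"
      unfolding N'_conj by (elim insertE emptyE) (simp_all add: conj_mat conj_mult N)
    moreover have "N' \<noteq> mat 1" "N' \<noteq> mat (-1)"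
      by (auto simp: N'_def mat_mat2 eq_neg_iff_add_eq_0)
    ultimately have "N' = mat2 a b c (- a) \<or> N' = mat2 (- a) (- b) (- c) a"
      by (simp add: mat_mat2 mat2_mult)
    then have "\<sigma> a = a \<and> \<sigma> b = b \<and> \<sigma> c = c \<or> \<sigma> a = - a \<and> \<sigma> b = - b \<and> \<sigma> c = - c"
      by (auto simp: N'_def)
    then have "\<sigma> z = z"
      using z(1) abc by (auto simp: hom_mult)
    with moved show False by contradiction
  qed
  then have q: "q = - p"
    using sq1(2,3) by (auto simp: eq_neg_iff_add_eq_0 add.commute) (metis add.commute distrib_left mult.commute mult_eq_0_iff)+
  define G where "G = {A. invertible A \<and> conj A \<in> M}"
  have G: "torus_submonoid G"
    by unfold_locales (auto simp: G_def conj_mult M_mult torus invertible_mult invertible_mat2)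
  have full: "M = {A. invertible A}" if "G = {A. invertible A}"
    using that invertible_unconj M_inv conj_unconj unfolding G_def by (metis (mono_tags, lifting) Collect_cong mem_Collect_eq Collect_mem_eq)
  have G_of_M: "unconj A \<in> G" if "A \<in> M" for A
    using that by (simp add: G_def invertible_unconj M_inv conj_unconj)
  \<comment> \<open>Each of the two Borel subgroups normalizes the line of its strictly triangular
    matrices; conjugated back into \<open>M\<close>, this line contradicts reductivity.\<close>
  have not_borel: False
    if E: "E ** E = 0" "E \<noteq> 0" and "\<And>x. mat 1 + mat x ** E \<in> G"
      and norm: "\<And>A. A \<in> G \<Longrightarrow> \<exists>c. A ** E = mat c ** E ** A" for E
  proof -
    have "\<not> reductive M"
    proof (rule not_reductive_if_normalizes_nilpotent[OF sub])
      have "conj 0 = 0"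
        using conj_mat[of 0] by (simp add: mat_mat2 flip: zero_mat2)
      then show "conj E ** conj E = 0" "conj E \<noteq> 0"
        using E unconj_conj by (metis conj_mult, metis)
      show "mat 1 + mat x ** conj E \<in> M" for x
        using that(3)[of x] by (simp add: G_def conj_add conj_mult conj_mat)
      show "\<exists>c. A ** conj E = mat c ** conj E ** A" if "A \<in> M" for A
        using norm[OF G_of_M[OF that]] by (metis conj_mult conj_mat conj_unconj)
    qed
    with red show False by contradiction
  qed
  \<comment> \<open>The parameters are entries of the idempotent \<open>(1 + unconj N') / 2\<close>,
    whose lower right entry is determined by \<open>q = - p\<close>.\<close>
  have "G = {A. invertible A} \<or> G = {A. invertible A \<and> A $ 2 $ 1 = 0}
    \<or> G = {A. invertible A \<and> A $ 1 $ 2 = 0}"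
  proof (rule torus_submonoid_trichotomy[OF G, of "(1 + p) / 2" "v / 2" "y / 2"])
    show "(1 + p) / 2 * (1 - (1 + p) / 2) = v / 2 * (y / 2)"
      using sq1(1) by (simp add: field_simps)
    show "v / 2 \<noteq> 0 \<or> y / 2 \<noteq> 0"
      using off by simp
    fix s :: complex assume s: "s \<in> {2, 3, 4}"
    let ?A = "mat2 (1 + (s - 1) * ((1 + p) / 2)) ((s - 1) * (v / 2)) ((s - 1) * (y / 2)) (1 + (s - 1) * (1 - (1 + p) / 2))"
    have "?A = mat 1 + mat ((s - 1) / 2) ** (mat 1 + mat2 p v y q)"
      by (simp add: q mat_mat2 mat2_mult mat2_add field_simps)
    then have "conj ?A = mat2 1 0 0 1 + mat ((s - 1) / 2) ** (mat 1 + N')"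
      by (simp add: conj_add conj_mult conj_mat N'_conj) (simp add: mat_mat2)
    then have *: "conj ?A \<in> M"
      using N'_in[OF s] by simp
    then have "invertible (unconj (conj ?A))"
      using M_inv invertible_unconj by blast
    with * show "?A \<in> G"
      by (simp add: G_def unconj_conj)
  qed
  moreover have False if "G = {A. invertible A \<and> A $ 2 $ 1 = 0}"
  proof (rule not_borel[of "mat2 0 1 0 0"])
    fix A assume "A \<in> G"
    then show "\<exists>c. A ** mat2 0 1 0 0 = mat c ** mat2 0 1 0 0 ** A"
      by (cases A rule: mat2_cases) (auto simp: that mat_mat2 mat2_mult invertible_mat2 intro!: exI[of _ "A$1$1 / A$2$2"])
  qed (auto simp: that mat_mat2 zero_mat2 mat2_mult mat2_add invertible_mat2)
  moreover have False if "G = {A. invertible A \<and> A $ 1 $ 2 = 0}"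
  proof (rule not_borel[of "mat2 0 0 1 0"])
    fix A assume "A \<in> G"
    then show "\<exists>c. A ** mat2 0 0 1 0 = mat c ** mat2 0 0 1 0 ** A"
      by (cases A rule: mat2_cases) (auto simp: that mat_mat2 mat2_mult invertible_mat2 intro!: exI[of _ "A$2$2 / A$1$1"])
  qed (auto simp: that mat_mat2 zero_mat2 mat2_mult mat2_add invertible_mat2)
  ultimately show ?thesis
    using full by blast
qed

text \<open>A least element is the only minimal one, which is what the definite description in
  \<open>MT\<close> needs.\<close>

lemma MT_eqI:
  assumes "reductive_containing_BMT h M"
    and "\<And>N. reductive_containing_BMT h N \<Longrightarrow> M \<subseteq> N"
  shows "MT h = M"
  unfolding MT_def
proof (rule the_equality)
  show "is_Mumford_Tate_group h M"
    using assms by (auto simp: is_Mumford_Tate_group_def)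
  show "N = M" if "is_Mumford_Tate_group h N" for N
    using that assms unfolding is_Mumford_Tate_group_def by metis
qed

lemma alg_subgroup_carrier_GL: "alg_subgroup (carrier (GL k)) (GL k)"
  unfolding alg_subgroup_def zariski_closed_def
  by (intro conjI group.subgroup_self[OF group_GL] exI[of _ "{}"]) simp_all

section \<open>Tori over the rationals\<close>

lemma of_real_of_rat: "of_real (of_rat q) = (of_rat q :: complex)"
  by (cases q) (simp add: of_rat_rat)

lemma generated_algebra_diff:
  assumes "-1 \<in> k" "f \<in> generated_algebra k S" "g \<in> generated_algebra k S"
  shows "(\<lambda>x. f x - g x) \<in> generated_algebra k S"
  using generated_algebra.add[OF assms(2) generated_algebra.mult[OF generated_algebra.const[OF assms(1)] assms(3)]]
  by simp

text \<open>The functions with regular pullback contain the constants and are stable under sums and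
  products, so generators decide.\<close>

lemma alg_homI:
  assumes "f \<in> hom G H" "regular H = generated_algebra k S" "regular G = generated_algebra k S'"
    and S: "\<And>s. s \<in> S \<Longrightarrow> \<exists>\<psi>\<in>regular G. \<forall>x\<in>carrier G. s (f x) = \<psi> x"
  shows "f \<in> alg_hom G H"
proof -
  have "\<exists>\<psi>\<in>regular G. \<forall>x\<in>carrier G. \<phi> (f x) = \<psi> x" if "\<phi> \<in> regular H" for \<phi>
    using that unfolding assms(2)
  proof induction
    case (const c)
    then show ?case
      by (intro bexI[of _ "\<lambda>_. c"]) (simp_all add: assms(3) generated_algebra.const)
  next
    case (gen s)
    then show ?case by (rule S)
  next
    case (add s t)
    then obtain \<psi> \<xi> where "\<psi> \<in> regular G" "\<forall>x\<in>carrier G. s (f x) = \<psi> x"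
      "\<xi> \<in> regular G" "\<forall>x\<in>carrier G. t (f x) = \<xi> x" by blast
    then show ?case
      by (intro bexI[of _ "\<lambda>x. \<psi> x + \<xi> x"]) (simp_all add: assms(3) generated_algebra.add)
  next
    case (mult s t)
    then obtain \<psi> \<xi> where "\<psi> \<in> regular G" "\<forall>x\<in>carrier G. s (f x) = \<psi> x"
      "\<xi> \<in> regular G" "\<forall>x\<in>carrier G. t (f x) = \<xi> x" by blast
    then show ?case
      by (intro bexI[of _ "\<lambda>x. \<psi> x * \<xi> x"]) (simp_all add: assms(3) generated_algebra.mult)
  qed
  with assms(1) show ?thesis
    by (simp add: alg_hom_def)
qed

text \<open>The field is \<open>\<rat> + \<rat> l\<close>. The basis is fixed as \<open>1, l\<close>
  to obtain the explicit multiplication table of numbers \<open>p + q l\<close>, which becomes the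
  group law of the Weil restriction.\<close>

lemma quadratic_basis:
  fixes l :: real and d :: rat and b :: "2 \<Rightarrow> real"
  assumes l: "l \<notin> \<rat>" and sq: "l * l = of_rat d"
    and b: "b = (\<lambda>i. if i = 1 then 1 else l)"
  shows "real_quadratic_field (rat_real.span (range b))" "rat_basis (rat_real.span (range b)) b"
    and "tensor_one b = vector [1, 0]"
    and "tensor_mult b v w = vector [v$1 * w$1 + of_rat d * v$2 * w$2, v$1 * w$2 + v$2 * w$1]"
proof -
  have b12: "b 1 = 1" "b 2 = l"
    by (simp_all add: b)
  have range_b: "range b = {l, 1}"
    by (auto simp: UNIV_2 b)
  have l1: "l \<noteq> 1"
    using l by auto
  have span: "rat_real.span {l, 1} = {of_rat p + of_rat q * l | p q. True}"
  proof -
    have *: "x - of_rat q * l = of_rat p * 1 \<longleftrightarrow> x = of_rat p + of_rat q * l" for x p q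
      by auto
    have "x \<in> rat_real.span {l, 1} \<longleftrightarrow> (\<exists>q p. x = of_rat p + of_rat q * l)" for x
      by (simp only: rat_real.span_insert[of l "{1}"] rat_real.span_singleton image_iff mem_Collect_eq * bex_UNIV)
    note ** = this
    show ?thesis
      unfolding set_eq_iff mem_Collect_eq ** by blast
  qed
  have l_in: "l \<in> rat_real.span {l, 1}" "1 \<in> rat_real.span {l, 1}"
    by (auto intro: rat_real.span_base)
  have indep: "rat_real.independent {l, 1}"
    using l l1 by (auto simp: rat_real.independent_insert rat_real.span_singleton)
  have "inj b"
    using l1 by (auto simp: inj_def b forall_2)
  then show "rat_basis (rat_real.span (range b)) b"
    using indep by (simp add: rat_basis_def range_b)
  have rep1: "rat_real.representation {l, 1} 1 = (\<lambda>v. if v = 1 then 1 else 0)"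
    and repl: "rat_real.representation {l, 1} l = (\<lambda>v. if v = l then 1 else 0)"
    by (rule rat_real.representation_basis[OF indep]; simp)+
  have repll: "rat_real.representation {l, 1} (l * l) = (\<lambda>v. d * (if v = 1 then 1 else 0))"
    using rat_real.representation_scale[OF indep l_in(2), of d] by (simp add: sq rep1)
  show "tensor_one b = vector [1, 0]"
    using l1 by (simp add: tensor_one_def range_b rep1 vec_eq_iff forall_2 b12)
  show "tensor_mult b v w = vector [v$1 * w$1 + of_rat d * v$2 * w$2, v$1 * w$2 + v$2 * w$1]"
    using l1 by (simp add: tensor_mult_def range_b rep1 repl repll vec_eq_iff forall_2 b12 sum_2 l1[symmetric])
  let ?E = "rat_real.span {l, 1}" and ?R = "ring_of_type_algebra :: real ring"
  interpret R: field ?R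
    by (rule field_from_type_algebra)
  have R: "carrier ?R = UNIV" "\<one>\<^bsub>?R\<^esub> = 1" "\<zero>\<^bsub>?R\<^esub> = 0" "x \<otimes>\<^bsub>?R\<^esub> y = x * y" "x \<oplus>\<^bsub>?R\<^esub> y = x + y" for x y
    by (simp_all add: ring_of_type_algebra_def)
  have R_minus: "\<ominus>\<^bsub>?R\<^esub> x = - x" for x
    by (rule R.minus_equality) (simp_all add: R)
  have R_inv: "inv\<^bsub>?R\<^esub> x = inverse x" if "x \<noteq> 0" for x
    by (rule R.inv_unique'[symmetric]) (simp_all add: R that)
  have E_I: "of_rat p + of_rat q * l \<in> ?E" for p q
    unfolding span by blast
  have E_E: "\<exists>p q. x = of_rat p + of_rat q * l" if "x \<in> ?E" for x
    using that unfolding span by blast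
  have E_mult: "x * y \<in> ?E" if xy: "x \<in> ?E" "y \<in> ?E" for x y
  proof -
    obtain p q r s where "x = of_rat p + of_rat q * l" "y = of_rat r + of_rat s * l"
      using E_E[OF xy(1)] E_E[OF xy(2)] by blast
    then have "x * y = of_rat (p * r) + (of_rat (q * s)) * (l * l) + of_rat (p * s + q * r) * l"
      by (simp add: of_rat_add of_rat_mult algebra_simps)
    also have "\<dots> = of_rat (p * r + q * s * d) + of_rat (p * s + q * r) * l"
      by (simp add: sq of_rat_add of_rat_mult)
    finally show ?thesis
      using E_I by simp
  qed
  have E_inverse: "inverse x \<in> ?E" if x: "x \<in> ?E" "x \<noteq> 0" for x
  proof -
    obtain p q where pq: "x = of_rat p + of_rat q * l"
      using E_E[OF x(1)] by blast
    have "x * (of_rat p - of_rat q * l) = of_rat (p * p) - of_rat (q * q) * (l * l)"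
      by (simp add: pq of_rat_mult algebra_simps)
    also have "\<dots> = of_rat (p * p - q * q * d)"
      by (simp add: sq of_rat_mult of_rat_diff)
    finally have norm: "x * (of_rat p - of_rat q * l) = of_rat (p * p - q * q * d)" .
    \<comment> \<open>Irrationality of \<open>l\<close> keeps the conjugate of \<open>x\<close>
      nonzero, so that the norm is nonzero and \<open>x\<close> can be inverted.\<close>
    have nz: "of_rat p - of_rat q * l \<noteq> 0"
    proof
      assume 0: "of_rat p - of_rat q * l = 0"
      then have "q = 0"
        using l by (metis Rats_divide Rats_of_rat eq_iff_diff_eq_0 nonzero_mult_div_cancel_left of_rat_eq_0_iff)
      with 0 pq x(2) show False by simp
    qed
    then have nz': "p * p - q * q * d \<noteq> 0"
      using norm x(2) by (metis mult_eq_0_iff of_rat_0)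
    define D where "D = p * p - q * q * d"
    have "inverse x = (of_rat p - of_rat q * l) / of_rat D"
      using norm x(2) nz nz' by (simp add: D_def field_simps)
    also have "\<dots> = of_rat (p / D) + of_rat (- q / D) * l"
      by (simp add: of_rat_divide of_rat_minus diff_divide_distrib)
    finally show ?thesis
      by (simp only: E_I)
  qed
  have "subfield ?E ?R"
  proof (rule R.subfieldI')
    show "subring ?E ?R"
      by (rule R.subringI) (auto simp: R R_minus l_in E_mult intro: rat_real.span_neg rat_real.span_add)
  qed (auto simp: R R_inv E_inverse)
  moreover have "rat_real.dim ?E = 2"
    using rat_real.dim_span_eq_card_independent[OF indep] l1 by simp
  ultimately show "real_quadratic_field (rat_real.span (range b))"
    by (simp add: real_quadratic_field_def range_b)
qed

text \<open>
  The invertible elements \<open>p + q N\<close> of the algebra generated by the trace zero matrix \<open>N\<close> with rows \<open>(a, b)\<close>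
  and \<open>(c, -a)\<close>, which satisfies \<open>N\<^sup>2 = d\<close>.
\<close>

locale rational_torus =
  fixes a b c d :: complex
  assumes rational: "a \<in> \<rat>" "b \<in> \<rat>" "c \<in> \<rat>"
    and d: "d = a * a + b * c" "d \<noteq> 0"
begin

definition elt :: "complex \<Rightarrow> complex \<Rightarrow> complex^2^2" where
  "elt p q = mat2 (p + q * a) (q * b) (q * c) (p - q * a)"

definition T :: "(complex^2^2) set" where
  "T = {elt p q | p q. p * p - d * (q * q) \<noteq> 0}"

definition re :: "complex^2^2 \<Rightarrow> complex" where
  "re A = (A$1$1 + A$2$2) / 2"

text \<open>This is \<open>tr (N A) / (2 d)\<close>, as \<open>re A\<close> is
  \<open>tr A / 2\<close>. Since \<open>tr N = 0\<close> and \<open>tr (N\<^sup>2) = 2 d\<close>,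
  the two recover the coordinates of \<open>p + q N\<close>, and by rational linear
  formulas.\<close>

definition im :: "complex^2^2 \<Rightarrow> complex" where
  "im A = (a * (A$1$1 - A$2$2) + b * A$2$1 + c * A$1$2) / (2 * d)"

lemma d_rational: "d \<in> \<rat>"
  using rational by (simp add: d(1))

lemma re_elt [simp]: "re (elt p q) = p" and im_elt [simp]: "im (elt p q) = q"
proof -
  have "a * (p + q * a - (p - q * a)) + b * (q * c) + c * (q * b) = q * (2 * d)"
    by (simp add: d(1) algebra_simps)
  then show "im (elt p q) = q"
    unfolding im_def elt_def mat2_nth using d(2) by simp
qed (simp add: re_def elt_def)

lemma det_elt: "det (elt p q) = p * p - d * (q * q)"
  by (simp add: elt_def det_mat2 d(1) algebra_simps)

lemma elt_mult: "elt p q ** elt p' q' = elt (p * p' + d * q * q') (p * q' + q * p')"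
  by (simp add: elt_def mat2_mult d(1) algebra_simps)

lemma elt_one: "elt 1 0 = mat 1"
  by (simp add: elt_def mat_mat2)

lemma elt_in_T: "elt p q \<in> T \<longleftrightarrow> p * p - d * (q * q) \<noteq> 0"
  unfolding T_def by (auto, metis re_elt im_elt)

lemma T_cases: "A \<in> T \<Longrightarrow> (\<And>p q. A = elt p q \<Longrightarrow> p * p - d * (q * q) \<noteq> 0 \<Longrightarrow> P) \<Longrightarrow> P"
  by (auto simp: T_def)

text \<open>The equations are entries of \<open>A N = N A\<close>. Being linear with rational
  coefficients, they exhibit the torus as closed over the rationals.\<close>

lemma T_eq_centralizer:
  "T = {A. invertible A \<and> a * A$1$1 + c * A$1$2 = a * A$1$1 + b * A$2$1
    \<and> b * A$1$1 - a * A$1$2 = a * A$1$2 + b * A$2$2 \<and> a * A$2$1 + c * A$2$2 = c * A$1$1 - a * A$2$1}"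
proof (intro equalityI subsetI CollectI)
  fix A assume "A \<in> T"
  then show "invertible A \<and> a * A$1$1 + c * A$1$2 = a * A$1$1 + b * A$2$1
    \<and> b * A$1$1 - a * A$1$2 = a * A$1$2 + b * A$2$2 \<and> a * A$2$1 + c * A$2$2 = c * A$1$1 - a * A$2$1"
    by (elim T_cases) (auto simp: invertible_det_nz det_elt, auto simp: elt_def algebra_simps)
next
  fix A :: "complex^2^2"
  obtain \<alpha> \<beta> \<gamma> \<delta> where A: "A = mat2 \<alpha> \<beta> \<gamma> \<delta>" by (rule mat2_cases)
  assume "A \<in> {A. invertible A \<and> a * A$1$1 + c * A$1$2 = a * A$1$1 + b * A$2$1
    \<and> b * A$1$1 - a * A$1$2 = a * A$1$2 + b * A$2$2 \<and> a * A$2$1 + c * A$2$2 = c * A$1$1 - a * A$2$1}"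
  then have inv: "invertible A" and eqs: "a * \<alpha> + c * \<beta> = a * \<alpha> + b * \<gamma>"
    "b * \<alpha> - a * \<beta> = a * \<beta> + b * \<delta>" "a * \<gamma> + c * \<delta> = c * \<alpha> - a * \<gamma>"
    unfolding A mat2_nth mem_Collect_eq by blast+
  \<comment> \<open>The factor in parentheses is \<open>tr (N A)\<close>; the identities say that
    \<open>im A\<close> times \<open>N\<close> is the trace free part of \<open>A\<close>.\<close>
  have "(a * (\<alpha> - \<delta>) + b * \<gamma> + c * \<beta>) * a = d * (\<alpha> - \<delta>)"
    "(a * (\<alpha> - \<delta>) + b * \<gamma> + c * \<beta>) * b = (2 * d) * \<beta>"
    "(a * (\<alpha> - \<delta>) + b * \<gamma> + c * \<beta>) * c = (2 * d) * \<gamma>"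
  proof -
    let ?S = "a * (\<alpha> - \<delta>) + b * \<gamma> + c * \<beta>"
    have 0: "c * \<beta> - b * \<gamma> = 0" "b * (\<alpha> - \<delta>) - 2 * a * \<beta> = 0" "c * (\<alpha> - \<delta>) - 2 * a * \<gamma> = 0"
      using eqs by (simp_all add: algebra_simps)
    have "?S * a - d * (\<alpha> - \<delta>) = a * (c * \<beta> - b * \<gamma>) - b * (c * (\<alpha> - \<delta>) - 2 * a * \<gamma>)"
      "?S * b - (2 * d) * \<beta> = a * (b * (\<alpha> - \<delta>) - 2 * a * \<beta>) - b * (c * \<beta> - b * \<gamma>)"
      "?S * c - (2 * d) * \<gamma> = a * (c * (\<alpha> - \<delta>) - 2 * a * \<gamma>) + c * (c * \<beta> - b * \<gamma>)"
      by (simp_all add: d(1) algebra_simps)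
    then show "?S * a = d * (\<alpha> - \<delta>)" "?S * b = (2 * d) * \<beta>" "?S * c = (2 * d) * \<gamma>"
      unfolding 0 by simp_all
  qed
  moreover have "im A = (a * (\<alpha> - \<delta>) + b * \<gamma> + c * \<beta>) / (2 * d)"
    by (simp add: im_def A)
  ultimately have "im A * a = (\<alpha> - \<delta>) / 2" "im A * b = \<beta>" "im A * c = \<gamma>"
    using d(2) by simp_all
  then have "A = elt (re A) (im A)"
    by (simp add: elt_def re_def A field_simps)
  with inv show "A \<in> T"
    by (metis det_elt elt_in_T invertible_det_nz)
qed

lemma T_invertible: "A \<in> T \<Longrightarrow> invertible A"
  by (simp add: T_eq_centralizer)

lemma entry_regular: "(\<lambda>A. A $ i $ j) \<in> regular (GL \<rat>)"
  unfolding GL_def alg_group.simps by (rule generated_algebra.gen) blast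

lemma inverse_det_regular: "(\<lambda>A. inverse (det A)) \<in> regular (GL \<rat>)"
  unfolding GL_def alg_group.simps by (rule generated_algebra.gen) blast

lemma const_regular: "q \<in> \<rat> \<Longrightarrow> (\<lambda>A. q) \<in> regular (GL \<rat>)"
  unfolding GL_def alg_group.simps by (rule generated_algebra.const)

lemma add_regular: "f \<in> regular (GL \<rat>) \<Longrightarrow> f' \<in> regular (GL \<rat>) \<Longrightarrow> (\<lambda>A. f A + f' A) \<in> regular (GL \<rat>)"
  unfolding GL_def alg_group.simps by (rule generated_algebra.add)

lemma mult_regular: "f \<in> regular (GL \<rat>) \<Longrightarrow> f' \<in> regular (GL \<rat>) \<Longrightarrow> (\<lambda>A. f A * f' A) \<in> regular (GL \<rat>)"
  unfolding GL_def alg_group.simps by (rule generated_algebra.mult)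

lemma diff_regular: "f \<in> regular (GL \<rat>) \<Longrightarrow> f' \<in> regular (GL \<rat>) \<Longrightarrow> (\<lambda>A. f A - f' A) \<in> regular (GL \<rat>)"
  unfolding GL_def alg_group.simps by (rule generated_algebra_diff) auto

lemmas regular_intros = diff_regular add_regular mult_regular entry_regular inverse_det_regular const_regular

lemma re_regular: "re \<in> regular (GL \<rat>)"
proof -
  have "(\<lambda>A. (1 / 2) * (A$1$1 + A$2$2)) \<in> regular (GL \<rat> :: (complex^2^2) alg_group)"
    by (intro regular_intros) auto
  then show ?thesis by (simp add: re_def[abs_def])
qed

lemma im_regular: "im \<in> regular (GL \<rat>)"
proof -
  have "(\<lambda>A. (1 / (2 * d)) * (a * (A$1$1 - A$2$2) + b * A$2$1 + c * A$1$2)) \<in> regular (GL \<rat> :: (complex^2^2) alg_group)"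
    by (intro regular_intros) (use rational d_rational in auto)
  then show ?thesis by (simp add: im_def[abs_def])
qed

lemma subgroup_T: "subgroup T (GL \<rat>)"
proof (rule group.subgroupI[OF group_GL])
  show "T \<subseteq> carrier (GL \<rat>)"
    using T_invertible by auto
  show "T \<noteq> {}"
    using elt_in_T[of 1 0] by auto
  fix A assume A: "A \<in> T"
  then obtain p q where pq: "A = elt p q" "p * p - d * (q * q) \<noteq> 0"
    by (rule T_cases)
  define D where "D = p * p - d * (q * q)"
  have "p * p / D - d * (q * q) / D = 1"
    using pq(2) by (simp add: D_def flip: diff_divide_distrib)
  then have "elt (p / D) (- q / D) ** elt p q = elt 1 0"
    by (simp add: elt_mult algebra_simps)
  then have "inv\<^bsub>GL \<rat>\<^esub> A = elt (p / D) (- q / D)"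
    using pq(2) T_invertible[OF A]
    by (intro group.inv_equality[OF group_GL]) (auto simp: pq(1) elt_one invertible_right_inverse invertible_left_inverse matrix_left_right_inverse)
  moreover have "(p / D) * (p / D) - d * ((- q / D) * (- q / D)) = D / (D * D)"
    by (simp add: D_def diff_divide_distrib)
  ultimately show "inv\<^bsub>GL \<rat>\<^esub> A \<in> T"
    using pq(2) by (simp add: elt_in_T D_def)
  fix B assume B: "B \<in> T"
  have "A ** B \<in> T"
    using A B det_elt elt_in_T elt_mult
    by (elim T_cases) (metis det_mul mult_eq_0_iff)
  then show "A \<otimes>\<^bsub>GL \<rat>\<^esub> B \<in> T"
    by simp
qed

lemma alg_subgroup_T: "alg_subgroup T (GL \<rat>)"
  unfolding alg_subgroup_def zariski_closed_def
proof (intro conjI exI)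
  let ?F = "{\<lambda>A. (a * A$1$1 + c * A$1$2) - (a * A$1$1 + b * A$2$1),
    \<lambda>A. (b * A$1$1 - a * A$1$2) - (a * A$1$2 + b * A$2$2),
    \<lambda>A. (a * A$2$1 + c * A$2$2) - (c * A$1$1 - a * A$2$1)} :: (complex^2^2 \<Rightarrow> complex) set"
  show "?F \<subseteq> regular (GL \<rat>)"
    unfolding insert_subset by (intro conjI empty_subsetI regular_intros rational)
  show "T = {A \<in> carrier (GL \<rat>). \<forall>f\<in>?F. f A = 0}"
    unfolding T_eq_centralizer
    by (simp only: GL_simps mem_Collect_eq ball_simps right_minus_eq simp_thms)
qed (rule subgroup_T)

lemma reductive_T: "reductive T"
proof (rule reductive_if_no_unipotents)
  fix u assume "u \<in> T" and u: "unipotent_matrix u"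
  then obtain p q where pq: "u = elt p q"
    by (elim T_cases)
  have "u = mat 1 + elt (p - 1) q"
    by (simp add: pq elt_def mat_mat2 mat2_add)
  with u have "unipotent_matrix (mat 1 + elt (p - 1) q)"
    by simp
  note * = unipotent_mat2D[OF this]
  from *(2) have "p = 1"
    by (simp add: elt_def eq_neg_iff_add_eq_0)
  with *(1) have "q = 0"
    using d(2) by (simp add: det_elt)
  with \<open>p = 1\<close> show "u = mat 1"
    by (simp add: pq elt_one)
qed

lemma regular_T: "regular ((GL \<rat>)\<lparr>carrier := T\<rparr>) = regular (GL \<rat>)"
  by simp

text \<open>\<open>r\<close> provides the inverse of the norm as a regular function, because this is
  the pullback of \<open>inverse (det A)\<close>. The criterion serves both the split torus and the
  Weil restriction.\<close>

lemma alg_hom_to_TI: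
  assumes regular: "regular G = generated_algebra \<rat> S"
    and p: "p \<in> regular G" and q: "q \<in> regular G" and r: "r \<in> regular G"
    and norm: "\<And>x. x \<in> carrier G \<Longrightarrow> (p x * p x - d * (q x * q x)) * r x = 1"
    and mult: "\<And>x y. x \<in> carrier G \<Longrightarrow> y \<in> carrier G \<Longrightarrow>
      p (x \<otimes>\<^bsub>G\<^esub> y) = p x * p y + d * q x * q y \<and> q (x \<otimes>\<^bsub>G\<^esub> y) = p x * q y + q x * p y"
  shows "(\<lambda>x. elt (p x) (q x)) \<in> alg_hom G ((GL \<rat>)\<lparr>carrier := T\<rparr>)"
proof (rule alg_homI[OF _ _ regular])
  show "(\<lambda>x. elt (p x) (q x)) \<in> hom G ((GL \<rat>)\<lparr>carrier := T\<rparr>)"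
  proof (rule homI)
    show "elt (p x) (q x) \<in> carrier ((GL \<rat>)\<lparr>carrier := T\<rparr>)" if "x \<in> carrier G" for x
      using norm[OF that] by (auto simp: elt_in_T)
  qed (simp add: elt_mult mult)
  show "regular ((GL \<rat>)\<lparr>carrier := T\<rparr>) = generated_algebra \<rat>
      (insert (\<lambda>A. inverse (det A)) {\<lambda>A :: complex^2^2. A $ i $ j | i j. True})"
    by (simp add: GL_def)
  fix s :: "complex^2^2 \<Rightarrow> complex"
  assume "s \<in> insert (\<lambda>A. inverse (det A)) {\<lambda>A. A $ i $ j | i j. True}"
  then consider "s = (\<lambda>A. inverse (det A))" | i j where "s = (\<lambda>A. A $ i $ j)"
    by blast
  then show "\<exists>\<psi>\<in>regular G. \<forall>x\<in>carrier G. s (elt (p x) (q x)) = \<psi> x"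
  proof cases
    case 1
    have "s (elt (p x) (q x)) = r x" if "x \<in> carrier G" for x
      using norm[OF that] by (simp add: 1 det_elt inverse_unique)
    with r show ?thesis by blast
  next
    case 2
    have const: "(\<lambda>x. k) \<in> regular G" if "k \<in> \<rat>" for k
      unfolding regular by (rule generated_algebra.const) fact
    have "(\<lambda>x. p x + q x * a) \<in> regular G" "(\<lambda>x. q x * b) \<in> regular G" "(\<lambda>x. q x * c) \<in> regular G"
      "(\<lambda>x. p x - q x * a) \<in> regular G"
      using p q const[OF rational(1)] const[OF rational(2)] const[OF rational(3)] unfolding regular
      by (intro generated_algebra.add generated_algebra.mult generated_algebra_diff; simp)+
    then have "(\<lambda>x. elt (p x) (q x) $ i $ j) \<in> regular G"
      using exhaust_2[of i] exhaust_2[of j] by (auto simp: elt_def)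
    then show ?thesis
      unfolding 2 by (rule bexI[rotated]) simp
  qed
qed

text \<open>The eigenvalues \<open>p + l q\<close> and \<open>p - l q\<close> of
  \<open>p + q N\<close> are characters over the rationals when \<open>l\<close> is rational. Their
  product is the determinant, so each one divided by it inverts the other.\<close>

lemma alg_isomorphic_Gm2:
  assumes l: "l \<in> \<rat>" "l * l = d"
  shows "alg_isomorphic ((GL \<rat>)\<lparr>carrier := T\<rparr>) (Gm2 \<rat>)"
proof -
  let ?f = "\<lambda>A. (re A + l * im A, re A - l * im A)"
  let ?p = "\<lambda>x :: complex \<times> complex. (1 / 2) * (fst x + snd x)"
  let ?q = "\<lambda>x :: complex \<times> complex. (1 / (2 * l)) * (fst x - snd x)"
  let ?r = "\<lambda>x :: complex \<times> complex. inverse (fst x) * inverse (snd x)"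
  have l0: "l \<noteq> 0"
    using l d by auto
  have norm: "(p + l * q) * (p - l * q) = p * p - d * (q * q)" for p q
    by (simp add: algebra_simps flip: l(2))
  have split: "p * p' + d * q * q' + l * (p * q' + q * p') = (p + l * q) * (p' + l * q')"
    "p * p' + d * q * q' - l * (p * q' + q * p') = (p - l * q) * (p' - l * q')" for p q p' q'
    by (simp_all add: algebra_simps flip: l(2))
  have "?f \<in> alg_hom ((GL \<rat>)\<lparr>carrier := T\<rparr>) (Gm2 \<rat>)"
  proof (rule alg_homI)
    show "?f \<in> hom ((GL \<rat>)\<lparr>carrier := T\<rparr>) (Gm2 \<rat>)"
    proof (rule homI)
      show "?f A \<in> carrier (Gm2 \<rat>)" if "A \<in> carrier ((GL \<rat>)\<lparr>carrier := T\<rparr>)" for A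
        using that by (auto elim!: T_cases simp: Gm2_def simp flip: norm)
      show "?f (A \<otimes>\<^bsub>(GL \<rat>)\<lparr>carrier := T\<rparr>\<^esub> B) = ?f A \<otimes>\<^bsub>Gm2 \<rat>\<^esub> ?f B"
        if "A \<in> carrier ((GL \<rat>)\<lparr>carrier := T\<rparr>)" "B \<in> carrier ((GL \<rat>)\<lparr>carrier := T\<rparr>)" for A B
        using that by (auto elim!: T_cases simp: Gm2_def elt_mult split)
    qed
    show "regular ((GL \<rat>)\<lparr>carrier := T\<rparr>) = generated_algebra \<rat>
      (insert (\<lambda>A. inverse (det A)) {\<lambda>A :: complex^2^2. A $ i $ j | i j. True})"
      by (simp add: GL_def)
    show "regular (Gm2 \<rat>) = generated_algebra \<rat> {fst, snd, \<lambda>p. inverse (fst p), \<lambda>p. inverse (snd p)}"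
      by (simp add: Gm2_def)
    have pm: "(\<lambda>A. re A + l * im A) \<in> regular (GL \<rat>)" "(\<lambda>A. re A - l * im A) \<in> regular (GL \<rat>)"
      by (intro regular_intros re_regular im_regular l)+
    have inv: "inverse (re A + l * im A) = (re A - l * im A) * inverse (det A)"
      "inverse (re A - l * im A) = (re A + l * im A) * inverse (det A)" if A_in: "A \<in> T" for A
    proof -
      obtain p q where A: "A = elt p q" "(p + l * q) * (p - l * q) \<noteq> 0"
        using T_cases[OF A_in] norm by metis
      have "inverse (det A) = inverse (p + l * q) * inverse (p - l * q)"
        unfolding A(1) det_elt norm[symmetric] by simp
      with A show "inverse (re A + l * im A) = (re A - l * im A) * inverse (det A)"
        "inverse (re A - l * im A) = (re A + l * im A) * inverse (det A)"
        by simp_all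
    qed
    fix s :: "complex \<times> complex \<Rightarrow> complex"
    assume "s \<in> {fst, snd, \<lambda>p. inverse (fst p), \<lambda>p. inverse (snd p)}"
    then consider "s = fst" | "s = snd" | "s = (\<lambda>p. inverse (fst p))" | "s = (\<lambda>p. inverse (snd p))"
      by blast
    then show "\<exists>\<psi>\<in>regular ((GL \<rat>)\<lparr>carrier := T\<rparr>). \<forall>A\<in>carrier ((GL \<rat>)\<lparr>carrier := T\<rparr>). s (?f A) = \<psi> A"
    proof cases
      case 1
      with pm show ?thesis by auto
    next
      case 2
      with pm show ?thesis by auto
    next
      case 3
      have "(\<lambda>A. (re A - l * im A) * inverse (det A)) \<in> regular (GL \<rat>)"
        by (intro mult_regular pm inverse_det_regular)
      with 3 inv(1) show ?thesis by auto
    next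
      case 4
      have "(\<lambda>A. (re A + l * im A) * inverse (det A)) \<in> regular (GL \<rat>)"
        by (intro mult_regular pm inverse_det_regular)
      with 4 inv(2) show ?thesis by auto
    qed
  qed
  moreover have "(\<lambda>x. elt (?p x) (?q x)) \<in> alg_hom (Gm2 \<rat>) ((GL \<rat>)\<lparr>carrier := T\<rparr>)"
  proof (rule alg_hom_to_TI[where r = ?r])
    show reg: "regular (Gm2 \<rat>) = generated_algebra \<rat> {fst, snd, \<lambda>p. inverse (fst p), \<lambda>p. inverse (snd p)}"
      by (simp add: Gm2_def)
    have gens: "fst \<in> regular (Gm2 \<rat>)" "snd \<in> regular (Gm2 \<rat>)" "(\<lambda>p. inverse (fst p)) \<in> regular (Gm2 \<rat>)"
      "(\<lambda>p. inverse (snd p)) \<in> regular (Gm2 \<rat>)" "(\<lambda>p. 1 / 2) \<in> regular (Gm2 \<rat>)" "(\<lambda>p. 1 / (2 * l)) \<in> regular (Gm2 \<rat>)"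
      unfolding reg by (auto intro: generated_algebra.gen intro!: generated_algebra.const simp: l)
    then show "?p \<in> regular (Gm2 \<rat>)" "?q \<in> regular (Gm2 \<rat>)" "?r \<in> regular (Gm2 \<rat>)"
      unfolding reg by (intro generated_algebra.add generated_algebra.mult generated_algebra_diff; simp)+
    show "(?p x * ?p x - d * (?q x * ?q x)) * ?r x = 1" if "x \<in> carrier (Gm2 \<rat>)" for x
    proof -
      have "?p x * ?p x - d * (?q x * ?q x) = fst x * snd x"
        using l0 by (simp add: field_simps flip: l(2))
      then show ?thesis
        using that by (simp only:) (auto simp: Gm2_def field_simps)
    qed
    show "?p (x \<otimes>\<^bsub>Gm2 \<rat>\<^esub> y) = ?p x * ?p y + d * ?q x * ?q y \<and> ?q (x \<otimes>\<^bsub>Gm2 \<rat>\<^esub> y) = ?p x * ?q y + ?q x * ?p y" for x y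
      using l0 by (cases x; cases y) (simp add: Gm2_def field_simps flip: l(2))
  qed
  moreover have "elt (?p (?f A)) (?q (?f A)) = A" if "A \<in> T" for A
    using that l0 by (elim T_cases) simp
  moreover have "?f (elt (?p x) (?q x)) = x" for x
    using l0 by (cases x) (simp add: field_simps)
  ultimately show ?thesis
    unfolding alg_isomorphic_def
    by (intro bexI[of _ ?f] bexI[of _ "\<lambda>x. elt (?p x) (?q x)"] conjI ballI) simp_all
qed

text \<open>As \<open>N\<close> squares to \<open>d\<close>, the matrices \<open>p + q N\<close>
  multiply like the numbers \<open>p + q l\<close> with \<open>l * l = d\<close>, so the coordinates
  \<open>(p, q)\<close> themselves give the isomorphism.\<close>

lemma alg_isomorphic_Res_Gm:
  fixes bas :: "2 \<Rightarrow> real"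
  assumes one: "tensor_one bas = vector [1, 0]"
    and mult: "\<And>v w. tensor_mult bas v w = vector [v$1 * w$1 + d * v$2 * w$2, v$1 * w$2 + v$2 * w$1]"
  shows "alg_isomorphic ((GL \<rat>)\<lparr>carrier := T\<rparr>) (Res_Gm bas)"
proof -
  define nm where "nm v = v$1 * v$1 - d * (v$2 * v$2)" for v :: "complex^2"
  have vec_eq: "v = w \<longleftrightarrow> v$1 = w$1 \<and> v$2 = w$2" for v w :: "complex^2"
    by (auto simp: vec_eq_iff forall_2)
  \<comment> \<open>The inverse is the conjugate divided by the norm; uniqueness is Cramer's rule
    for the two linear equations in \<open>w\<close>.\<close>
  have unit: "tensor_mult bas v w = tensor_one bas \<longleftrightarrow> nm v \<noteq> 0 \<and> w = vector [v$1 / nm v, - v$2 / nm v]" for v w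
  proof
    assume "tensor_mult bas v w = tensor_one bas"
    then have eqs: "v$1 * w$1 + d * v$2 * w$2 = 1" "v$1 * w$2 + v$2 * w$1 = 0"
      by (simp_all add: mult one vec_eq)
    have "nm v * w$1 = v$1 * (v$1 * w$1 + d * v$2 * w$2) - d * v$2 * (v$1 * w$2 + v$2 * w$1)"
      "nm v * w$2 = v$1 * (v$1 * w$2 + v$2 * w$1) - v$2 * (v$1 * w$1 + d * v$2 * w$2)"
      by (simp_all add: nm_def algebra_simps)
    then have "nm v * w$1 = v$1" "nm v * w$2 = - v$2"
      unfolding eqs by simp_all
    moreover have "nm v \<noteq> 0"
    proof
      assume "nm v = 0"
      with calculation have "v$1 = 0" "v$2 = 0" by simp_all
      with eqs show False by simp
    qed
    ultimately show "nm v \<noteq> 0 \<and> w = vector [v$1 / nm v, - v$2 / nm v]"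
      by (simp add: vec_eq field_simps)
  next
    assume "nm v \<noteq> 0 \<and> w = vector [v$1 / nm v, - v$2 / nm v]"
    moreover from this have "v$1 * v$1 / nm v - d * v$2 * v$2 / nm v = 1"
      by (simp add: nm_def mult.assoc flip: diff_divide_distrib)
    ultimately show "tensor_mult bas v w = tensor_one bas"
      by (simp add: mult one vec_eq)
  qed
  have carrier: "carrier (Res_Gm bas) = {v. nm v \<noteq> 0}"
    by (simp add: Res_Gm_def unit)
  have inverse: "tensor_inverse bas v = vector [v$1 / nm v, - v$2 / nm v]" if "nm v \<noteq> 0" for v
    unfolding tensor_inverse_def using that by (simp add: unit)
  have reg: "regular (Res_Gm bas) = generated_algebra \<rat> ({\<lambda>v. v $ i | i. True} \<union> {\<lambda>v. tensor_inverse bas v $ i | i. True})"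
    by (simp add: Res_Gm_def)
  have coord: "(\<lambda>v. v $ i) \<in> regular (Res_Gm bas)" "(\<lambda>v. tensor_inverse bas v $ i) \<in> regular (Res_Gm bas)" for i
    unfolding reg by (rule generated_algebra.gen, blast)+
  have const: "(\<lambda>v. k) \<in> regular (Res_Gm bas)" if "k \<in> \<rat>" for k
    unfolding reg using that by (rule generated_algebra.const)
  let ?f = "\<lambda>A. vector [re A, im A] :: complex^2"
  have "?f \<in> alg_hom ((GL \<rat>)\<lparr>carrier := T\<rparr>) (Res_Gm bas)"
  proof (rule alg_homI[OF _ reg])
    show "?f \<in> hom ((GL \<rat>)\<lparr>carrier := T\<rparr>) (Res_Gm bas)"
    proof (rule homI)
      show "?f A \<in> carrier (Res_Gm bas)" if "A \<in> carrier ((GL \<rat>)\<lparr>carrier := T\<rparr>)" for A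
        using that by (auto elim!: T_cases simp: carrier nm_def)
      show "?f (A \<otimes>\<^bsub>(GL \<rat>)\<lparr>carrier := T\<rparr>\<^esub> B) = ?f A \<otimes>\<^bsub>Res_Gm bas\<^esub> ?f B"
        if "A \<in> carrier ((GL \<rat>)\<lparr>carrier := T\<rparr>)" "B \<in> carrier ((GL \<rat>)\<lparr>carrier := T\<rparr>)" for A B
        using that by (auto elim!: T_cases simp: Res_Gm_def elt_mult mult)
    qed
    show "regular ((GL \<rat>)\<lparr>carrier := T\<rparr>) = generated_algebra \<rat>
      (insert (\<lambda>A. inverse (det A)) {\<lambda>A :: complex^2^2. A $ i $ j | i j. True})"
      by (simp add: GL_def)
    have inv: "tensor_inverse bas (?f A) = vector [re A * inverse (det A), (-1) * im A * inverse (det A)]"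
      if "A \<in> T" for A
      using that by (auto elim!: T_cases simp: inverse nm_def det_elt divide_inverse)
    fix s :: "complex^2 \<Rightarrow> complex"
    assume "s \<in> {\<lambda>v. v $ i | i. True} \<union> {\<lambda>v. tensor_inverse bas v $ i | i. True}"
    then consider i where "s = (\<lambda>v. v $ i)" | i where "s = (\<lambda>v. tensor_inverse bas v $ i)"
      by blast
    then show "\<exists>\<psi>\<in>regular ((GL \<rat>)\<lparr>carrier := T\<rparr>). \<forall>A\<in>carrier ((GL \<rat>)\<lparr>carrier := T\<rparr>). s (?f A) = \<psi> A"
    proof cases
      case 1
      have "\<forall>A\<in>T. s (?f A) = (if i = 1 then re else im) A"
        using exhaust_2[of i] by (auto simp: 1)
      moreover have "(if i = 1 then re else im) \<in> regular (GL \<rat>)"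
        using re_regular im_regular by simp
      ultimately show ?thesis
        by (simp only: regular_T) auto
    next
      case 2
      have "(\<lambda>A. re A * inverse (det A)) \<in> regular (GL \<rat>)" "(\<lambda>A. (-1) * im A * inverse (det A)) \<in> regular (GL \<rat>)"
        by (intro regular_intros re_regular im_regular; simp)+
      then show ?thesis
        using exhaust_2[of i] by (elim disjE) (auto simp: 2 inv simp del: mult_minus_left)
    qed
  qed
  moreover have "(\<lambda>v. elt (v $ 1) (v $ 2)) \<in> alg_hom (Res_Gm bas) ((GL \<rat>)\<lparr>carrier := T\<rparr>)"
  proof (rule alg_hom_to_TI[OF reg coord(1) coord(1)])
    \<comment> \<open>The norm of the inverse is the inverse of the norm, here expressed through
      regular functions.\<close>
    let ?r = "\<lambda>v. tensor_inverse bas v $ 1 * tensor_inverse bas v $ 1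
      - d * (tensor_inverse bas v $ 2 * tensor_inverse bas v $ 2)"
    show "?r \<in> regular (Res_Gm bas)"
      using coord(2) const[OF d_rational] unfolding reg
      by (intro generated_algebra.mult generated_algebra_diff) auto
    show "(v $ 1 * v $ 1 - d * (v $ 2 * v $ 2)) * ?r v = 1" if "v \<in> carrier (Res_Gm bas)" for v
    proof -
      have nz: "nm v \<noteq> 0"
        using that by (simp add: carrier)
      have "?r v = (v $ 1 * v $ 1 - d * (v $ 2 * v $ 2)) / (nm v * nm v)"
        by (simp add: inverse[OF nz] diff_divide_distrib)
      with nz show ?thesis
        by (simp flip: nm_def)
    qed
    show "(v \<otimes>\<^bsub>Res_Gm bas\<^esub> w) $ 1 = v $ 1 * w $ 1 + d * v $ 2 * w $ 2 \<and>
      (v \<otimes>\<^bsub>Res_Gm bas\<^esub> w) $ 2 = v $ 1 * w $ 2 + v $ 2 * w $ 1" for v w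
      by (simp add: Res_Gm_def mult)
  qed
  moreover have "elt (?f A $ 1) (?f A $ 2) = A" if "A \<in> T" for A
    using that by (elim T_cases) simp
  moreover have "?f (elt (v $ 1) (v $ 2)) = v" for v
    by (simp add: vec_eq)
  ultimately show ?thesis
    unfolding alg_isomorphic_def
    by (intro bexI[of _ ?f] bexI[of _ "\<lambda>v. elt (v $ 1) (v $ 2)"] conjI ballI) simp_all
qed

end

context rational_torus
begin

text \<open>The rational matrix of the locale is \<open>l\<close> times the involution of
  \<open>h\<close>, so the torus of \<open>h\<close> is all of \<open>T\<close> and every competitor
  contains it by density.\<close>

lemma MT_eq_T:
  assumes h: "h \<in> X_h0" and "conjugation g g'" and conj: "\<And>p. h p = conjugation.conj g g' (h0 p)"
    and N: "conjugation.conj g g' (mat2 1 0 0 (-1)) = mat2 (a / l) (b / l) (c / l) (- a / l)"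
    and l: "l * l = d"
  shows "MT h = T"
proof -
  interpret conjugation g g' by fact
  have l0: "l \<noteq> 0"
    using l d by auto
  have h_elt: "h (x, y) = elt ((x + y) / 2) ((x - y) / (2 * l))" for x y
  proof -
    have "h0 (x, y) = mat ((x + y) / 2) + mat ((x - y) / 2) ** mat2 1 0 0 (-1)"
      by (simp add: h0_mat2 mat_mat2 mat2_mult mat2_add field_simps)
    then have "h (x, y) = mat ((x + y) / 2) + mat ((x - y) / 2) ** mat2 (a / l) (b / l) (c / l) (- a / l)"
      by (simp add: conj conj_add conj_mult conj_mat N)
    then show ?thesis
      using l0 by (simp add: elt_def mat_mat2 mat2_mult mat2_add)
  qed
  have norm: "((x + y) / 2) * ((x + y) / 2) - d * ((x - y) / (2 * l) * ((x - y) / (2 * l))) = x * y" for x y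
    using l0 by (simp add: field_simps flip: l)
  have h_in: "h (x, y) \<in> T" if "x \<noteq> 0" "y \<noteq> 0" for x y
    unfolding h_elt elt_in_T norm using that by simp
  \<comment> \<open>The preimage of \<open>p + q N\<close> is its pair of eigenvalues
    \<open>p + l q\<close> and \<open>p - l q\<close>.\<close>
  have T_h: "\<exists>x y. x \<noteq> 0 \<and> y \<noteq> 0 \<and> A = h (x, y)" if A_in: "A \<in> T" for A
  proof -
    obtain p q where A: "A = elt p q" "p * p - d * (q * q) \<noteq> 0"
      using A_in by (rule T_cases)
    have "p * p - d * (q * q) = (p + l * q) * (p - l * q)"
      by (simp add: algebra_simps flip: l)
    with A have "p + l * q \<noteq> 0" "p - l * q \<noteq> 0"
      by auto
    moreover have "A = h (p + l * q, p - l * q)"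
      using l0 by (simp add: h_elt A)
    ultimately show ?thesis by blast
  qed
  have "BMT h \<subseteq> T"
  proof (rule BMT_smallest(2)[OF h], intro conjI alg_subgroup_T subsetI)
    fix A assume A: "A \<in> h ` points \<real> (Gm2 \<real>)"
    then have "A \<in> points \<real> ((GL \<rat>)\<lparr>carrier := BMT h\<rparr>)"
      using BMT_smallest(1)[OF h] by blast
    moreover have "A \<in> T"
      using A h_in by (auto simp: points_Gm2)
    ultimately show "A \<in> points \<real> ((GL \<rat>)\<lparr>carrier := T\<rparr>)"
      by (simp add: points_def)
  qed
  then show ?thesis
    using alg_subgroup_T reductive_T T_h torus_subset[OF h]
    by (intro MT_eqI) (auto simp: reductive_containing_BMT_def, blast)
qed

end

theorem theorem1p4p3:
  fixes h :: "complex \<times> complex \<Rightarrow> complex^2^2"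
  assumes "h \<in> X_h0"
  shows "MT h = carrier (GL \<rat>)
    \<or> (\<exists>(E :: real set) (b :: 2 \<Rightarrow> real). real_quadratic_field E \<and> rat_basis E b \<and>
         alg_isomorphic ((GL \<rat>)\<lparr>carrier := MT h\<rparr>) (Res_Gm b))
    \<or> alg_isomorphic ((GL \<rat>)\<lparr>carrier := MT h\<rparr>) (Gm2 \<rat>)"
proof -
  obtain g g' where "conjugation g g'" and conj: "\<And>p. h p = conjugation.conj g g' (h0 p)"
    and real: "\<And>i j. g $ i $ j \<in> \<real>" "\<And>i j. g' $ i $ j \<in> \<real>"
    using X_h0_cases[OF assms] by blast
  interpret conjugation g g' by fact
  define N where "N = conj (mat2 1 0 0 (-1))"
  obtain a b c e where N_eq: "N = mat2 a b c e" by (rule mat2_cases)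
  have "trace N = trace (mat2 1 0 0 (-1 :: complex))"
    unfolding N_def conj_def by (metis inverse_left matrix_mul_assoc matrix_mul_lid trace_mul_sym)
  then have e: "e = - a"
    by (simp add: N_eq trace_def sum_2 eq_neg_iff_add_eq_0 add.commute)
  have "N ** N = mat 1"
    by (simp add: N_def mat2_mult conj_mat flip: conj_mult mat_mat2)
  then have sq: "a * a + b * c = 1"
    by (simp add: N_eq mat2_mult mat_mat2)
  have "N $ i $ j \<in> \<real>" for i j
    unfolding N_def conj_def by (simp add: matrix_matrix_mult_def sum_2 real)
  from this[of 1 1] this[of 1 2] this[of 2 1] have abc_real: "a \<in> \<real>" "b \<in> \<real>" "c \<in> \<real>"
    by (simp_all add: N_eq)
  show ?thesis
  proof (cases "{a * a, a * b, a * c, b * b, b * c, c * c} \<subseteq> \<rat>")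
    case False
    then obtain z where z: "z \<in> {a * a, a * b, a * c, b * b, b * c, c * c}" "z \<notin> \<rat>"
      by blast
    have full: "M = {A. invertible A}" if "reductive_containing_BMT h M" for M
      using reductive_full[OF assms conj N_eq[unfolded N_def e] z that] .
    have "alg_subgroup (BMT h) (GL \<rat>)"
      using BMT_smallest(1)[OF assms] by blast
    then have "BMT h \<subseteq> carrier (GL \<rat>)"
      by (meson alg_subgroup_def subgroup.subset)
    then have "reductive_containing_BMT h {A. invertible A}"
      using alg_subgroup_carrier_GL[of \<rat>] reductive_GL by (simp add: reductive_containing_BMT_def)
    then have "MT h = {A. invertible A}"
      by (rule MT_eqI) (use full in blast)
    then show ?thesis by simp
  next
    case True
    \<comment> \<open>Any nonzero entry serves as \<open>l\<close>: then \<open>l * l\<close> and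
      the entries of \<open>l N\<close> are products of two entries of \<open>N\<close>, hence
      rational.\<close>
    have "a \<noteq> 0 \<or> b \<noteq> 0"
      using sq by auto
    then obtain l where l: "l \<in> {a, b, c}" "l \<noteq> 0"
      by blast
    have rational: "l * a \<in> \<rat>" "l * b \<in> \<rat>" "l * c \<in> \<rat>" "l * l \<in> \<rat>"
      using True l(1) by (auto simp: mult.commute)
    have "l * l = (l * l) * (a * a + b * c)"
      by (simp add: sq)
    then have "l * l = (l * a) * (l * a) + (l * b) * (l * c)"
      by (simp add: algebra_simps)
    then interpret rational_torus "l * a" "l * b" "l * c" "l * l"
      using rational l(2) by unfold_locales auto
    have MT: "MT h = T"
    proof (rule MT_eq_T[OF assms \<open>conjugation g g'\<close> conj])
      show "conj (mat2 1 0 0 (-1)) = mat2 (l * a / l) (l * b / l) (l * c / l) (- (l * a) / l)"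
        using l(2) N_eq by (simp add: N_def e)
    qed simp
    show ?thesis
    proof (cases "l \<in> \<rat>")
      case True
      then show ?thesis
        using alg_isomorphic_Gm2[OF True] by (simp add: MT)
    next
      case False
      \<comment> \<open>As an entry of a real matrix \<open>l\<close> is real, so the quadratic
        field it generates lies in the real numbers.\<close>
      obtain r where r: "l = of_real r"
        using l(1) abc_real by (auto elim!: Reals_cases)
      obtain q where q: "l * l = of_rat q"
        using d_rational by (auto elim: Rats_cases)
      have "complex_of_real (r * r) = of_real (of_rat q)"
        using q by (simp add: r of_real_of_rat)
      then have rr: "r * r = of_rat q"
        by (simp only: of_real_eq_iff)
      have "r \<notin> \<rat>"
        using False by (auto simp: r of_real_of_rat elim!: Rats_cases)
      note basis = quadratic_basis[OF this rr refl]
      have "alg_isomorphic ((GL \<rat>)\<lparr>carrier := T\<rparr>) (Res_Gm (\<lambda>i :: 2. if i = 1 then 1 else r))"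
        by (rule alg_isomorphic_Res_Gm) (use basis(3,4) q in simp_all)
      then show ?thesis
        using basis(1,2) unfolding MT by blast
    qed
  qed
qed

end
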